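(* Let $q \in S(\emptyset)$ be relatively $\mathcal{P}$-internal via the $\emptyset$-definable function $\pi$, with associated $\emptyset$-type-definable groupoid $\mathcal{G} = \mathcal{G}(q,\pi/\mathcal{P})$. If $\mathcal{G}$ is retractable and $\pi(q)$ is $\mathcal{P}$-internal, then $q$ is $\mathcal{P}$-internal.
   Context: Work in a monster model $\mathbb{M}$ of a stable theory eliminating imaginaries, with $\mathrm{acl}(\emptyset)=\emptyset$ (i.e. elements algebraic over $\emptyset$ are regarded as $\emptyset$-definable, so complete types over $\emptyset$ are stationary). $\mathcal{P}$ is a family of partial types over $\emptyset$; one also writes $\mathcal{P}$ for the set of tuples realizing some partial type in $\mathcal{P}$. $\Phi(\mathbb{M})$ denotes the set of realizations of $\Phi$. A stationary type $s$ over $C$ is $\mathcal{P}$-internal if there are $B \supseteq C$, $a \models s$ independent of $B$ over $C$, and a tuple $\overline{c}$ of realizations of $\mathcal{P}$ with $a \in \mathrm{dcl}(\overline{c},B)$. $\pi$ is an $\emptyset$-definable function whose domain contains $q(\mathbb{M})$; $\pi(q)$ is the type over $\emptyset$ of $\pi(a)$ for $a \models q$. $q$ is relatively $\mathcal{P}$-internal via $\pi$ if for any $a\models q$, $q_{\pi(a)} := \mathrm{tp}(a/\pi(a))$ is stationary and $\mathcal{P}$-internal. The groupoid $\mathcal{G}(q,\pi/\mathcal{P})$ has as objects the realizations of $\pi(q)$, and $\mathrm{Mor}(\pi(a),\pi(b))$ is the set of bijections $q_{\pi(a)}(\mathbb{M}) \to q_{\pi(b)}(\mathbb{M})$ induced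 by automorphisms of $\mathbb{M}$ fixing $\mathcal{P}$ pointwise and taking $\pi(a)$ to $\pi(b)$. This groupoid is identified with an $\emptyset$-type-definable groupoid (it is isomorphic to one, with relatively $\emptyset$-definable action $(\sigma,a)\mapsto\sigma(a)$ on $q(\mathbb{M})$). A groupoid is connected if $\mathrm{Mor}(a,b) \neq \emptyset$ for all objects $a,b$. An $\emptyset$-type-definable groupoid is retractable if it is connected and there is an $\emptyset$-definable partial function $g(x,y)=g_{x,y}$ with $g_{a,b} \in \mathrm{Mor}(a,b)$ for all objects $a,b$, and $g_{b,c} \circ g_{a,b} = g_{a,c}$ for all objects $a,b,c$. *)

theory Defs
  imports Main
begin

unbundle cardinal_syntax

section \<open>Many-sorted first-order logic\<close>

text \<open>
  Languages are many-sorted with sorts \<open>'s\<close> (take \<open>'s = unit\<close> for a one-sorted theory), so that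
  theories such as \<open>T = T\<^sup>e\<^sup>q\<close> are covered.  Formulas use de Bruijn indices and are evaluated in a
  finite list of elements: \<open>\<phi>(x, b)\<close> is \<open>sat M (x @ b) \<phi>\<close>.  Function symbols are interpreted by
  partial functions, undefined on arguments of the wrong length or sorts.  Ill-formed terms and variables beyond
  the end of the list have no value, and an atomic formula containing such a term is false.  So
  every formula, without side condition, defines over \<open>\<emptyset>\<close> a set of tuples of any given sorts.
\<close>

datatype 'f trm = Var nat | Fn 'f "'f trm list"

datatype ('f, 'r, 's) fm =
    Eq "'f trm" "'f trm"
  | Rel 'r "'f trm list"
  | Neg "('f, 'r, 's) fm"
  | Conj "('f, 'r, 's) fm" "('f, 'r, 's) fm"
  | Ex 's "('f, 'r, 's) fm"

record ('f, 'r, 's, 'm) model =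
  sort_of :: "'m \<Rightarrow> 's"
  fun_of :: "'f \<Rightarrow> 'm list \<Rightarrow> 'm option"
  rel_of :: "'r \<Rightarrow> 'm list \<Rightarrow> bool"

primrec eval :: "('f, 'r, 's, 'm) model \<Rightarrow> 'm list \<Rightarrow> 'f trm \<Rightarrow> 'm option" where
  "eval M e (Var i) = (if i < length e then Some (e ! i) else None)"
| "eval M e (Fn f ts) = Option.bind (those (map (eval M e) ts)) (fun_of M f)"

primrec sat :: "('f, 'r, 's, 'm) model \<Rightarrow> 'm list \<Rightarrow> ('f, 'r, 's) fm \<Rightarrow> bool" where
  "sat M e (Eq t u) \<longleftrightarrow> (\<exists>x. eval M e t = Some x \<and> eval M e u = Some x)"
| "sat M e (Rel r ts) \<longleftrightarrow> (\<exists>xs. those (map (eval M e) ts) = Some xs \<and> rel_of M r xs)"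
| "sat M e (Neg \<phi>) \<longleftrightarrow> \<not> sat M e \<phi>"
| "sat M e (Conj \<phi> \<psi>) \<longleftrightarrow> sat M e \<phi> \<and> sat M e \<psi>"
| "sat M e (Ex s \<phi>) \<longleftrightarrow> (\<exists>x. sort_of M x = s \<and> sat M (x # e) \<phi>)"

definition tuples :: "('f, 'r, 's, 'm) model \<Rightarrow> 's list \<Rightarrow> 'm list set" where
  "tuples M ss = {a. map (sort_of M) a = ss}"

definition automorphism :: "('f, 'r, 's, 'm) model \<Rightarrow> ('m \<Rightarrow> 'm) \<Rightarrow> bool" where
  "automorphism M \<sigma> \<longleftrightarrow>
     bij \<sigma> \<and>
     (\<forall>x. sort_of M (\<sigma> x) = sort_of M x) \<and>
     (\<forall>f xs. fun_of M f (map \<sigma> xs) = map_option \<sigma> (fun_of M f xs)) \<and>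
     (\<forall>r xs. rel_of M r (map \<sigma> xs) \<longleftrightarrow> rel_of M r xs)"

section \<open>Definable sets and types\<close>

definition definable :: "('f, 'r, 's, 'm) model \<Rightarrow> 'm set \<Rightarrow> 's list \<Rightarrow> 'm list set \<Rightarrow> bool" where
  "definable M A ss X \<longleftrightarrow>
     (\<exists>\<phi> bs. set bs \<subseteq> A \<and> X = {x \<in> tuples M ss. sat M (x @ bs) \<phi>})"

definition definable_fun ::
  "('f, 'r, 's, 'm) model \<Rightarrow> 'm set \<Rightarrow> 's list \<Rightarrow> 's list \<Rightarrow> ('m list \<rightharpoonup> 'm list) \<Rightarrow> bool" where
  "definable_fun M A ss ts f \<longleftrightarrow>
     dom f \<subseteq> tuples M ss \<and> ran f \<subseteq> tuples M ts \<and>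
     definable M A (ss @ ts) {x @ y | x y. f x = Some y}"

definition dcl :: "('f, 'r, 's, 'm) model \<Rightarrow> 'm set \<Rightarrow> 'm set" where
  "dcl M A = {a. \<exists>\<phi> bs. set bs \<subseteq> A \<and>
     {x. sort_of M x = sort_of M a \<and> sat M (x # bs) \<phi>} = {a}}"

definition acl :: "('f, 'r, 's, 'm) model \<Rightarrow> 'm set \<Rightarrow> 'm set" where
  "acl M A = {a. \<exists>\<phi> bs. set bs \<subseteq> A \<and> sat M (a # bs) \<phi> \<and>
     finite {x. sort_of M x = sort_of M a \<and> sat M (x # bs) \<phi>}}"

text \<open>
  A type consists of the sorts of its variables together with a set of formulas with parameters;
  the pair \<open>(\<phi>, bs)\<close> stands for the formula \<open>\<phi>(x, bs)\<close>.
\<close>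

type_synonym ('f, 'r, 's, 'm) ptype = "'s list \<times> (('f, 'r, 's) fm \<times> 'm list) set"

definition realizations :: "('f, 'r, 's, 'm) model \<Rightarrow> ('f, 'r, 's, 'm) ptype \<Rightarrow> 'm list set" where
  "realizations M p = {a \<in> tuples M (fst p). \<forall>(\<phi>, bs) \<in> snd p. sat M (a @ bs) \<phi>}"

definition partial_type :: "('f, 'r, 's, 'm) model \<Rightarrow> 'm set \<Rightarrow> ('f, 'r, 's, 'm) ptype \<Rightarrow> bool" where
  "partial_type M A p \<longleftrightarrow>
     (\<forall>(\<phi>, bs) \<in> snd p. set bs \<subseteq> A) \<and>
     (\<forall>F \<subseteq> snd p. finite F \<longrightarrow> realizations M (fst p, F) \<noteq> {})"

definition complete_type :: "('f, 'r, 's, 'm) model \<Rightarrow> 'm set \<Rightarrow> ('f, 'r, 's, 'm) ptype \<Rightarrow> bool" where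
  "complete_type M A p \<longleftrightarrow>
     partial_type M A p \<and>
     (\<forall>\<phi> bs. set bs \<subseteq> A \<longrightarrow> (\<phi>, bs) \<in> snd p \<or> (Neg \<phi>, bs) \<in> snd p)"

definition tp :: "('f, 'r, 's, 'm) model \<Rightarrow> 'm set \<Rightarrow> 'm list \<Rightarrow> ('f, 'r, 's, 'm) ptype" where
  "tp M A a = (map (sort_of M) a, {(\<phi>, bs). set bs \<subseteq> A \<and> sat M (a @ bs) \<phi>})"

definition type_definable :: "('f, 'r, 's, 'm) model \<Rightarrow> 'm set \<Rightarrow> 's list \<Rightarrow> 'm list set \<Rightarrow> bool" where
  "type_definable M A ss X \<longleftrightarrow>
     (\<exists>\<Phi>. (\<forall>(\<phi>, bs) \<in> \<Phi>. set bs \<subseteq> A) \<and> X = realizations M (ss, \<Phi>))"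

definition relatively_definable ::
  "('f, 'r, 's, 'm) model \<Rightarrow> 'm set \<Rightarrow> 's list \<Rightarrow> 'm list set \<Rightarrow> 'm list set \<Rightarrow> bool" where
  "relatively_definable M A ss Z X \<longleftrightarrow> (\<exists>D. definable M A ss D \<and> X = Z \<inter> D)"

section \<open>Monster models, stability, elimination of imaginaries\<close>

definition small :: "'k rel \<Rightarrow> 'm set \<Rightarrow> bool" where
  "small \<kappa> A \<longleftrightarrow> |A| <o \<kappa>"

definition saturated :: "'k rel \<Rightarrow> ('f, 'r, 's, 'm) model \<Rightarrow> bool" where
  "saturated \<kappa> M \<longleftrightarrow>
     (\<forall>A p. small \<kappa> A \<and> partial_type M A p \<longrightarrow> realizations M p \<noteq> {})"

definition strongly_homogeneous :: "'k rel \<Rightarrow> ('f, 'r, 's, 'm) model \<Rightarrow> bool" where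
  "strongly_homogeneous \<kappa> M \<longleftrightarrow>
     (\<forall>A f. small \<kappa> A \<and>
        (\<forall>x\<in>A. sort_of M (f x) = sort_of M x) \<and>
        (\<forall>\<phi> bs. set bs \<subseteq> A \<longrightarrow> (sat M (map f bs) \<phi> \<longleftrightarrow> sat M bs \<phi>)) \<longrightarrow>
        (\<exists>\<sigma>. automorphism M \<sigma> \<and> (\<forall>x\<in>A. \<sigma> x = f x)))"

text \<open>
  Only these two properties are asked of the monster model, for some \<open>\<kappa>\<close> larger than the number of
  formulas.  A saturated model of cardinality \<open>\<kappa>\<close> is an instance.
\<close>

definition monster :: "'k rel \<Rightarrow> ('f, 'r, 's, 'm) model \<Rightarrow> bool" where
  "monster \<kappa> M \<longleftrightarrow>
     Card_order \<kappa> \<and> |UNIV :: ('f, 'r, 's) fm set| <o \<kappa> \<and>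
     saturated \<kappa> M \<and> strongly_homogeneous \<kappa> M"

text \<open>Since \<open>M\<close> is \<open>\<aleph>\<^sub>1\<close>-saturated, the order property for its theory can be tested in \<open>M\<close>.\<close>

definition stable_theory :: "('f, 'r, 's, 'm) model \<Rightarrow> bool" where
  "stable_theory M \<longleftrightarrow>
     \<not> (\<exists>\<phi> ss ts (a :: nat \<Rightarrow> 'm list) b.
          (\<forall>i. a i \<in> tuples M ss \<and> b i \<in> tuples M ts) \<and>
          (\<forall>i j. sat M (a i @ b j) \<phi> \<longleftrightarrow> i < j))"

text \<open>Every class of an \<open>\<emptyset>\<close>-definable equivalence relation has a real tuple as canonical parameter.\<close>

definition eliminates_imaginaries :: "('f, 'r, 's, 'm) model \<Rightarrow> bool" where
  "eliminates_imaginaries M \<longleftrightarrow>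
     (\<forall>ss \<epsilon>. equiv (tuples M ss)
               {(x, y). x \<in> tuples M ss \<and> y \<in> tuples M ss \<and> sat M (x @ y) \<epsilon>} \<longrightarrow>
        (\<forall>a \<in> tuples M ss. \<exists>\<psi> ts. \<exists>!b. b \<in> tuples M ts \<and>
           (\<forall>x \<in> tuples M ss. sat M (x @ b) \<psi> \<longleftrightarrow> sat M (x @ a) \<epsilon>)))"

section \<open>Forking, stationarity, internality\<close>

definition divides ::
  "('f, 'r, 's, 'm) model \<Rightarrow> 'm set \<Rightarrow> 's list \<Rightarrow> ('f, 'r, 's) fm \<Rightarrow> 'm list \<Rightarrow> bool" where
  "divides M C ss \<phi> b \<longleftrightarrow>
     (\<exists>(d :: nat \<Rightarrow> 'm list) k. (\<forall>i. tp M C (d i) = tp M C b) \<and>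
        (\<forall>I. finite I \<and> card I = k \<longrightarrow>
           \<not> (\<exists>x \<in> tuples M ss. \<forall>i\<in>I. sat M (x @ d i) \<phi>)))"

definition forks :: "('f, 'r, 's, 'm) model \<Rightarrow> 'm set \<Rightarrow> ('f, 'r, 's, 'm) ptype \<Rightarrow> bool" where
  "forks M C p \<longleftrightarrow>
     (\<exists>D. finite D \<and> (\<forall>(\<phi>, b) \<in> D. divides M C (fst p) \<phi> b) \<and>
        (\<forall>x \<in> realizations M p. \<exists>(\<phi>, b) \<in> D. sat M (x @ b) \<phi>))"

definition independent :: "('f, 'r, 's, 'm) model \<Rightarrow> 'm set \<Rightarrow> 'm list \<Rightarrow> 'm set \<Rightarrow> bool" where
  "independent M C a B \<longleftrightarrow> \<not> forks M C (tp M (B \<union> C) a)"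

definition stationary ::
  "'k rel \<Rightarrow> ('f, 'r, 's, 'm) model \<Rightarrow> 'm set \<Rightarrow> ('f, 'r, 's, 'm) ptype \<Rightarrow> bool" where
  "stationary \<kappa> M C s \<longleftrightarrow>
     complete_type M C s \<and>
     (\<forall>B. small \<kappa> B \<and> C \<subseteq> B \<longrightarrow>
        (\<exists>!p. complete_type M B p \<and> fst p = fst s \<and> snd s \<subseteq> snd p \<and> \<not> forks M C p))"

definition realizes_family :: "('f, 'r, 's, 'm) model \<Rightarrow> ('f, 'r, 's, 'm) ptype set \<Rightarrow> 'm list set" where
  "realizes_family M P = (\<Union>\<Phi>\<in>P. realizations M \<Phi>)"

text \<open>
  Used only for stationary types \<open>s\<close> over \<open>C\<close>.  Under \<open>acl(\<emptyset>) = dcl(\<emptyset>)\<close>, in a stable theory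
  eliminating imaginaries, these include all complete types over \<open>\<emptyset>\<close>.
\<close>

definition internal ::
  "'k rel \<Rightarrow> ('f, 'r, 's, 'm) model \<Rightarrow> ('f, 'r, 's, 'm) ptype set \<Rightarrow> 'm set \<Rightarrow>
   ('f, 'r, 's, 'm) ptype \<Rightarrow> bool" where
  "internal \<kappa> M P C s \<longleftrightarrow>
     (\<exists>B a cs. small \<kappa> B \<and> C \<subseteq> B \<and> a \<in> realizations M s \<and> independent M C a B \<and>
        set cs \<subseteq> realizes_family M P \<and> set a \<subseteq> dcl M (set (concat cs) \<union> B))"

definition relatively_internal ::
  "'k rel \<Rightarrow> ('f, 'r, 's, 'm) model \<Rightarrow> ('f, 'r, 's, 'm) ptype set \<Rightarrow>
   ('m list \<rightharpoonup> 'm list) \<Rightarrow> ('f, 'r, 's, 'm) ptype \<Rightarrow> bool" where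
  "relatively_internal \<kappa> M P \<pi> q \<longleftrightarrow>
     (\<forall>a \<in> realizations M q. \<exists>u. \<pi> a = Some u \<and>
        stationary \<kappa> M (set u) (tp M (set u) a) \<and>
        internal \<kappa> M P (set u) (tp M (set u) a))"

section \<open>Groupoids\<close>

record ('o, 'h) gpd =
  Obj :: "'o set"
  Mor :: "'h set"
  Dom :: "'h \<Rightarrow> 'o"
  Cod :: "'h \<Rightarrow> 'o"
  Comp :: "'h \<Rightarrow> 'h \<Rightarrow> 'h"

definition hom_set :: "('o, 'h) gpd \<Rightarrow> 'o \<Rightarrow> 'o \<Rightarrow> 'h set" where
  "hom_set G u v = {f \<in> Mor G. Dom G f = u \<and> Cod G f = v}"

definition identity_at :: "('o, 'h) gpd \<Rightarrow> 'o \<Rightarrow> 'h \<Rightarrow> bool" where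
  "identity_at G u e \<longleftrightarrow>
     e \<in> hom_set G u u \<and>
     (\<forall>f \<in> Mor G. Dom G f = u \<longrightarrow> Comp G f e = f) \<and>
     (\<forall>f \<in> Mor G. Cod G f = u \<longrightarrow> Comp G e f = f)"

definition groupoid :: "('o, 'h) gpd \<Rightarrow> bool" where
  "groupoid G \<longleftrightarrow>
     (\<forall>f \<in> Mor G. Dom G f \<in> Obj G \<and> Cod G f \<in> Obj G) \<and>
     (\<forall>u v w. \<forall>f \<in> hom_set G u v. \<forall>g \<in> hom_set G v w. Comp G g f \<in> hom_set G u w) \<and>
     (\<forall>u v w z. \<forall>f \<in> hom_set G u v. \<forall>g \<in> hom_set G v w. \<forall>h \<in> hom_set G w z.
        Comp G h (Comp G g f) = Comp G (Comp G h g) f) \<and>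
     (\<forall>u \<in> Obj G. \<exists>e. identity_at G u e) \<and>
     (\<forall>u v. \<forall>f \<in> hom_set G u v. \<exists>g \<in> hom_set G v u.
        identity_at G u (Comp G g f) \<and> identity_at G v (Comp G f g))"

definition connected_groupoid :: "('o, 'h) gpd \<Rightarrow> bool" where
  "connected_groupoid G \<longleftrightarrow> (\<forall>u \<in> Obj G. \<forall>v \<in> Obj G. hom_set G u v \<noteq> {})"

text \<open>Isomorphism that is the identity on objects.\<close>

definition groupoid_iso :: "('h \<Rightarrow> 'h2) \<Rightarrow> ('o, 'h) gpd \<Rightarrow> ('o, 'h2) gpd \<Rightarrow> bool" where
  "groupoid_iso F H G \<longleftrightarrow>
     Obj H = Obj G \<and> bij_betw F (Mor H) (Mor G) \<and>
     (\<forall>h \<in> Mor H. Dom G (F h) = Dom H h \<and> Cod G (F h) = Cod H h) \<and>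
     (\<forall>g \<in> Mor H. \<forall>f \<in> Mor H. Dom H g = Cod H f \<longrightarrow> F (Comp H g f) = Comp G (F g) (F f))"

text \<open>
  Relative definability of the identity and inverse maps is not listed, as it follows from that of
  source, target and composition.
\<close>

definition type_definable_groupoid ::
  "('f, 'r, 's, 'm) model \<Rightarrow> 's list \<Rightarrow> 's list \<Rightarrow> ('m list, 'm list) gpd \<Rightarrow> bool" where
  "type_definable_groupoid M os ms H \<longleftrightarrow>
     groupoid H \<and>
     type_definable M {} os (Obj H) \<and> type_definable M {} ms (Mor H) \<and>
     relatively_definable M {} (ms @ os)
       {h @ u | h u. h \<in> Mor H \<and> u \<in> Obj H} {h @ Dom H h | h. h \<in> Mor H} \<and>
     relatively_definable M {} (ms @ os)
       {h @ u | h u. h \<in> Mor H \<and> u \<in> Obj H} {h @ Cod H h | h. h \<in> Mor H} \<and>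
     relatively_definable M {} (ms @ ms @ ms)
       {g @ f @ h | g f h. g \<in> Mor H \<and> f \<in> Mor H \<and> h \<in> Mor H}
       {g @ f @ Comp H g f | g f. g \<in> Mor H \<and> f \<in> Mor H \<and> Dom H g = Cod H f}"

definition retractable ::
  "('f, 'r, 's, 'm) model \<Rightarrow> 's list \<Rightarrow> 's list \<Rightarrow> ('m list, 'm list) gpd \<Rightarrow> bool" where
  "retractable M os ms H \<longleftrightarrow>
     connected_groupoid H \<and>
     (\<exists>g. definable_fun M {} (os @ os) ms g \<and>
        (\<forall>u \<in> Obj H. \<forall>v \<in> Obj H. \<exists>h \<in> hom_set H u v. g (u @ v) = Some h) \<and>
        (\<forall>u \<in> Obj H. \<forall>v \<in> Obj H. \<forall>w \<in> Obj H.
           Comp H (the (g (v @ w))) (the (g (u @ v))) = the (g (u @ w))))"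

section \<open>The groupoid of a relatively internal type\<close>

text \<open>The type \<open>\<pi>(q)\<close>; by completeness of \<open>q\<close> the type of \<open>\<pi>(a)\<close> does not depend on \<open>a\<close>.\<close>

definition image_type ::
  "('f, 'r, 's, 'm) model \<Rightarrow> ('m list \<rightharpoonup> 'm list) \<Rightarrow> ('f, 'r, 's, 'm) ptype \<Rightarrow>
   ('f, 'r, 's, 'm) ptype" where
  "image_type M \<pi> q = (THE p. \<forall>a \<in> realizations M q. p = tp M {} (the (\<pi> a)))"

text \<open>The type \<open>q\<^sub>u\<close>, equal to \<open>tp(a/u)\<close> for every \<open>a \<Turnstile> q\<close> with \<open>\<pi>(a) = u\<close>.\<close>

definition fibre_type ::
  "('f, 'r, 's, 'm) model \<Rightarrow> ('m list \<rightharpoonup> 'm list) \<Rightarrow> ('f, 'r, 's, 'm) ptype \<Rightarrow> 'm list \<Rightarrow>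
   ('f, 'r, 's, 'm) ptype" where
  "fibre_type M \<pi> q u =
     (THE p. \<exists>a \<in> realizations M q. \<pi> a = Some u \<and> p = tp M (set u) a)"

definition aut_over ::
  "('f, 'r, 's, 'm) model \<Rightarrow> ('f, 'r, 's, 'm) ptype set \<Rightarrow> ('m \<Rightarrow> 'm) set" where
  "aut_over M P = {\<sigma>. automorphism M \<sigma> \<and> (\<forall>c \<in> realizes_family M P. map \<sigma> c = c)}"

text \<open>
  A morphism from \<open>u\<close> to \<open>v\<close> is recorded as \<open>(u, f, v)\<close>, where the partial map \<open>f\<close> is the
  restriction to \<open>q\<^sub>u(M)\<close> of an automorphism; it is a bijection onto \<open>q\<^sub>v(M)\<close>.
\<close>

definition binding_groupoid ::
  "('f, 'r, 's, 'm) model \<Rightarrow> ('f, 'r, 's, 'm) ptype set \<Rightarrow> ('m list \<rightharpoonup> 'm list) \<Rightarrow>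
   ('f, 'r, 's, 'm) ptype \<Rightarrow>
   ('m list, 'm list \<times> ('m list \<rightharpoonup> 'm list) \<times> 'm list) gpd" where
  "binding_groupoid M P \<pi> q =
     \<lparr>Obj = realizations M (image_type M \<pi> q),
      Mor = {(u, f, v).
               u \<in> realizations M (image_type M \<pi> q) \<and> v \<in> realizations M (image_type M \<pi> q) \<and>
               (\<exists>\<sigma> \<in> aut_over M P. map \<sigma> u = v \<and>
                  f = (\<lambda>x. Some (map \<sigma> x)) |` realizations M (fibre_type M \<pi> q u))},
      Dom = (\<lambda>(u, f, v). u),
      Cod = (\<lambda>(u, f, v). v),
      Comp = (\<lambda>(v', g, w) (u, f, v). (u, g \<circ>\<^sub>m f, w))\<rparr>"

text \<open>
  \<open>H\<close> is an \<open>\<emptyset>\<close>-type-definable groupoid with which \<open>\<G>(q, \<pi>/P)\<close> is identified: there is an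
  isomorphism \<open>F\<close> through which \<open>H\<close> acts relatively \<open>\<emptyset>\<close>-definably on \<open>q(M)\<close>.
\<close>

definition type_definable_binding_groupoid ::
  "('f, 'r, 's, 'm) model \<Rightarrow> ('f, 'r, 's, 'm) ptype set \<Rightarrow> ('m list \<rightharpoonup> 'm list) \<Rightarrow>
   ('f, 'r, 's, 'm) ptype \<Rightarrow> 's list \<Rightarrow> 's list \<Rightarrow> ('m list, 'm list) gpd \<Rightarrow> bool" where
  "type_definable_binding_groupoid M P \<pi> q os ms H \<longleftrightarrow>
     type_definable_groupoid M os ms H \<and>
     (\<exists>F. groupoid_iso F H (binding_groupoid M P \<pi> q) \<and>
        relatively_definable M {} (ms @ fst q @ fst q)
          {h @ a @ b | h a b. h \<in> Mor H \<and> a \<in> realizations M q \<and> b \<in> realizations M q}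
          {h @ a @ b | h a b. h \<in> Mor H \<and> (fst (snd (F h))) a = Some b})"

end

theory Submission
  imports Defs
begin

text \<open>
  By hypothesis there is \<open>u\<^sub>0 \<Turnstile> \<pi>(q)\<close>, independent of some \<open>B\<^sub>0\<close>, with \<open>u\<^sub>0 \<in> dcl(P, B\<^sub>0)\<close>; and in the
  fibre over \<open>u\<^sub>0\<close> there is \<open>b\<^sub>1\<close>, independent of some \<open>B\<^sub>1 \<supseteq> u\<^sub>0\<close> over \<open>u\<^sub>0\<close>, with \<open>b\<^sub>1 \<in> dcl(P, B\<^sub>1)\<close>.
  Put \<open>D = B\<^sub>0 \<union> B\<^sub>1\<close>.  The plan is to move a generic element of \<open>q\<close> into the single fibre over \<open>u\<^sub>0\<close>
  along the retraction \<open>g\<close>, and to use internality only there.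

  Choose \<open>u \<equiv> u\<^sub>0\<close> over \<open>B\<^sub>0\<close> independent of \<open>D\<close>, and then \<open>a\<close> in the fibre over \<open>u\<close> independent of
  \<open>D\<close> over \<open>u\<close>.  By transitivity of forking on the left, \<open>ua\<close> is independent of \<open>D\<close>.  The element
  \<open>b = g(u, u\<^sub>0)(a)\<close> lies in the fibre over \<open>u\<^sub>0\<close> and in \<open>dcl(a, u, u\<^sub>0)\<close>, so it is independent of \<open>D\<close>
  over \<open>u\<^sub>0\<close>; by stationarity of the fibre it has the type of \<open>b\<^sub>1\<close> over \<open>B\<^sub>1\<close>, whence
  \<open>b \<in> dcl(P, B\<^sub>1)\<close>, as \<open>P\<close> is invariant under automorphisms.  Likewise \<open>u \<in> dcl(P, B\<^sub>0)\<close>.  Since morphisms act by bijections, \<open>a\<close> is in turn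
  definable from \<open>b\<close>, \<open>u\<close>, \<open>u\<^sub>0\<close>, hence \<open>a \<in> dcl(P, D)\<close>, while \<open>a \<Turnstile> q\<close> is independent of \<open>D\<close>.

  Three properties of forking carry this: extension (\<open>nonforking_extension\<close>), passing to a tuple
  definable over base and tuple (\<open>independent_definable\<close>), and left transitivity
  (\<open>independent_append\<close>).  The last is the
  only delicate one; it turns dividing over \<open>\<emptyset>\<close> into dividing over \<open>u\<close>, for which the dividing
  sequence has to be constructed by compactness (\<open>divides_by_compactness\<close>).  Transport between
  fibres is \<open>retraction_transport\<close>.
\<close>

section \<open>Expressible relations\<close>

text \<open>
  Formulas refer to their environment by position, so rearranging or repeating entries of the
  environment is a substitution of variables: \<open>js ! i\<close> is the new position of variable \<open>i\<close>.  The
  number \<open>n\<close> is the length of the new environment; a variable that had no value is sent to position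
  \<open>n\<close>, where it again has none.
\<close>

primrec ren_trm :: "nat \<Rightarrow> nat list \<Rightarrow> 'f trm \<Rightarrow> 'f trm" where
  "ren_trm n js (Var i) = Var (if i < length js then js ! i else n)"
| "ren_trm n js (Fn f ts) = Fn f (map (ren_trm n js) ts)"

primrec ren_fm :: "nat \<Rightarrow> nat list \<Rightarrow> ('f, 'r, 's) fm \<Rightarrow> ('f, 'r, 's) fm" where
  "ren_fm n js (Eq t u) = Eq (ren_trm n js t) (ren_trm n js u)"
| "ren_fm n js (Rel r ts) = Rel r (map (ren_trm n js) ts)"
| "ren_fm n js (Neg \<phi>) = Neg (ren_fm n js \<phi>)"
| "ren_fm n js (Conj \<phi> \<psi>) = Conj (ren_fm n js \<phi>) (ren_fm n js \<psi>)"
| "ren_fm n js (Ex s \<phi>) = Ex s (ren_fm (Suc n) (0 # map Suc js) \<phi>)"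

lemma eval_ren_trm:
  assumes "set js \<subseteq> {..<length e}"
  shows "eval M e (ren_trm (length e) js t) = eval M (map ((!) e) js) t"
proof (induction t)
  case (Var i)
  then show ?case using assms by (auto simp: subset_iff)
next
  case (Fn f ts)
  then have "map (eval M e \<circ> ren_trm (length e) js) ts = map (eval M (map ((!) e) js)) ts"
    by (intro map_cong) auto
  then show ?case by (simp only: ren_trm.simps eval.simps map_map)
qed

lemma sat_ren_fm:
  assumes "set js \<subseteq> {..<length e}"
  shows "sat M e (ren_fm (length e) js \<phi>) \<longleftrightarrow> sat M (map ((!) e) js) \<phi>"
  using assms
proof (induction \<phi> arbitrary: e js)
  case (Eq t u)
  then show ?case by (simp add: eval_ren_trm)
next
  case (Rel r ts)
  then have "map (eval M e \<circ> ren_trm (length e) js) ts = map (eval M (map ((!) e) js)) ts"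
    by (intro map_cong) (auto simp: eval_ren_trm)
  then show ?case by (simp only: ren_fm.simps sat.simps map_map)
next
  case (Ex s \<phi>)
  have "sat M (x # e) (ren_fm (Suc (length e)) (0 # map Suc js) \<phi>)
      \<longleftrightarrow> sat M (x # map ((!) e) js) \<phi>" for x
  proof -
    have "set (0 # map Suc js) \<subseteq> {..<length (x # e)}"
      using Ex.prems by auto
    from Ex.IH[OF this] show ?thesis by (simp add: comp_def)
  qed
  then show ?case by simp
qed simp_all

text \<open>
  Formulas needed below are not written out.  They are given as predicates on environments, built up by
  the closure properties of \<open>expressible\<close>.
\<close>

definition expressible :: "('f, 'r, 's, 'm) model \<Rightarrow> nat \<Rightarrow> ('m list \<Rightarrow> bool) \<Rightarrow> bool" where
  "expressible M n R \<longleftrightarrow> (\<exists>\<phi>. \<forall>e. length e = n \<longrightarrow> (sat M e \<phi> \<longleftrightarrow> R e))"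

text \<open>
  The rearrangements of an environment of length \<open>n\<close> under which expressible predicates are stable.
\<close>

definition selects :: "nat \<Rightarrow> nat \<Rightarrow> ('m list \<Rightarrow> 'm list) \<Rightarrow> bool" where
  "selects n m f \<longleftrightarrow>
     (\<exists>js. length js = m \<and> set js \<subseteq> {..<n} \<and> (\<forall>e. length e = n \<longrightarrow> f e = map ((!) e) js))"

lemma selects_append:
  assumes "selects n k f" "selects n l g" "m = k + l"
  shows "selects n m (\<lambda>e. f e @ g e)"
proof -
  obtain js ls where "length js = k" "set js \<subseteq> {..<n}" "\<forall>e. length e = n \<longrightarrow> f e = map ((!) e) js"
    "length ls = l" "set ls \<subseteq> {..<n}" "\<forall>e. length e = n \<longrightarrow> g e = map ((!) e) ls"
    using assms(1,2) by (auto simp: selects_def)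
  then show ?thesis
    unfolding selects_def using assms(3) by (intro exI[of _ "js @ ls"]) auto
qed

lemma selects_block:
  assumes "k + m \<le> n"
  shows "selects n m (\<lambda>e. take m (drop k e))"
proof -
  have "take m (drop k e) = map ((!) e) [k..<k + m]" if "length e = n" for e :: "'a list"
    using assms that by (intro nth_equalityI) auto
  then show ?thesis
    unfolding selects_def using assms by (intro exI[of _ "[k..<k + m]"]) auto
qed

lemma selects_take:
  assumes "m \<le> n"
  shows "selects n m (take m)"
  using selects_block[of 0 m n] assms by simp

lemma selects_drop:
  assumes "n = k + m"
  shows "selects n m (drop k)"
proof -
  have "selects n m (\<lambda>e::'a list. take m (drop k e))"
    using assms by (intro selects_block) simp
  then show ?thesis
    using assms unfolding selects_def by auto
qed

lemma selects_map:
  assumes "selects n m f" "set js \<subseteq> {..<m}" "k = length js"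
  shows "selects n k (\<lambda>e. map ((!) (f e)) js)"
proof -
  obtain ls where ls: "length ls = m" "set ls \<subseteq> {..<n}" "\<forall>e. length e = n \<longrightarrow> f e = map ((!) e) ls"
    using assms(1) by (auto simp: selects_def)
  have "map ((!) (f e)) js = map ((!) e) (map ((!) ls) js)" if "length e = n" for e
    using ls assms(2) that by (auto simp: subset_iff)
  moreover have "set (map ((!) ls) js) \<subseteq> {..<n}"
    using ls assms(2) by (force simp: subset_iff)
  ultimately show ?thesis
    unfolding selects_def using assms(3) by (intro exI[of _ "map ((!) ls) js"]) auto
qed

lemma expressible_selects:
  assumes "expressible M m R" "selects n m f"
  shows "expressible M n (\<lambda>e. R (f e))"
proof -
  obtain \<phi> where \<phi>: "\<And>e. length e = m \<Longrightarrow> sat M e \<phi> \<longleftrightarrow> R e"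
    using assms(1) by (auto simp: expressible_def)
  obtain js where js: "length js = m" "set js \<subseteq> {..<n}" "\<And>e. length e = n \<Longrightarrow> f e = map ((!) e) js"
    using assms(2) by (auto simp: selects_def)
  have "sat M e (ren_fm n js \<phi>) \<longleftrightarrow> R (f e)" if "length e = n" for e
    using sat_ren_fm[of js e M \<phi>] \<phi>[of "f e"] js that by simp
  then show ?thesis unfolding expressible_def by blast
qed

lemma expressible_sat:
  assumes "selects n m f"
  shows "expressible M n (\<lambda>e. sat M (f e) \<phi>)"
proof (rule expressible_selects[OF _ assms])
  show "expressible M m (\<lambda>e. sat M e \<phi>)" by (auto simp: expressible_def)
qed

lemma expressible_cong:
  assumes "expressible M n R" "\<And>e. length e = n \<Longrightarrow> R e \<longleftrightarrow> S e"
  shows "expressible M n S"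
  using assms by (simp add: expressible_def)

lemma expressible_not:
  assumes "expressible M n R"
  shows "expressible M n (\<lambda>e. \<not> R e)"
proof -
  obtain \<phi> where "\<forall>e. length e = n \<longrightarrow> (sat M e \<phi> \<longleftrightarrow> R e)"
    using assms by (auto simp: expressible_def)
  then show ?thesis unfolding expressible_def by (intro exI[of _ "Neg \<phi>"]) simp
qed

lemma expressible_conj:
  assumes "expressible M n R" "expressible M n S"
  shows "expressible M n (\<lambda>e. R e \<and> S e)"
proof -
  obtain \<phi> \<psi> where "\<forall>e. length e = n \<longrightarrow> (sat M e \<phi> \<longleftrightarrow> R e)"
    "\<forall>e. length e = n \<longrightarrow> (sat M e \<psi> \<longleftrightarrow> S e)"
    using assms by (auto simp: expressible_def)
  then show ?thesis unfolding expressible_def by (intro exI[of _ "Conj \<phi> \<psi>"]) simp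
qed

lemma expressible_True: "expressible M n (\<lambda>e. True)"
  unfolding expressible_def
  by (rule exI[of _ "Neg (Conj (Eq (Var 0) (Var 0)) (Neg (Eq (Var 0) (Var 0))))"]) simp

lemma expressible_ball:
  assumes "finite I" "\<And>i. i \<in> I \<Longrightarrow> expressible M n (R i)"
  shows "expressible M n (\<lambda>e. \<forall>i\<in>I. R i e)"
  using assms
  by (induction I rule: finite_induct) (simp_all add: expressible_True expressible_conj)

lemma expressible_ex:
  assumes "expressible M (length ss + n) R"
  shows "expressible M n (\<lambda>e. \<exists>x\<in>tuples M ss. R (x @ e))"
  using assms
proof (induction ss arbitrary: R)
  case Nil
  then show ?case by (simp add: tuples_def)
next
  case (Cons s ss)
  obtain \<phi> where \<phi>: "\<And>e. length e = length (s # ss) + n \<Longrightarrow> sat M e \<phi> \<longleftrightarrow> R e"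
    using Cons.prems by (auto simp: expressible_def)
  have "expressible M (length ss + n) (\<lambda>e. \<exists>x. sort_of M x = s \<and> R (x # e))"
    unfolding expressible_def by (rule exI[of _ "Ex s \<phi>"]) (simp add: \<phi>)
  from Cons.IH[OF this] show ?case
  proof (rule expressible_cong)
    fix e
    show "(\<exists>xs\<in>tuples M ss. \<exists>x. sort_of M x = s \<and> R (x # xs @ e))
        \<longleftrightarrow> (\<exists>x\<in>tuples M (s # ss). R (x @ e))"
    proof
      assume "\<exists>xs\<in>tuples M ss. \<exists>x. sort_of M x = s \<and> R (x # xs @ e)"
      then obtain xs x where "xs \<in> tuples M ss" "sort_of M x = s" "R (x # xs @ e)" by blast
      then show "\<exists>x\<in>tuples M (s # ss). R (x @ e)"
        by (intro bexI[of _ "x # xs"]) (auto simp: tuples_def)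
    next
      assume "\<exists>x\<in>tuples M (s # ss). R (x @ e)"
      then obtain x xs where "x # xs \<in> tuples M (s # ss)" "R (x # xs @ e)"
        by (fastforce simp: tuples_def)
      then show "\<exists>xs\<in>tuples M ss. \<exists>x. sort_of M x = s \<and> R (x # xs @ e)"
        by (intro bexI[of _ xs] exI[of _ x]) (auto simp: tuples_def)
    qed
  qed
qed

lemma expressible_eq:
  assumes "2 * m \<le> n"
  shows "expressible M n (\<lambda>e. take m e = take m (drop m e))"
proof -
  have "expressible M n (\<lambda>e. e ! i = e ! (m + i))" if "i < m" for i
    unfolding expressible_def
    by (rule exI[of _ "Eq (Var i) (Var (m + i))"]) (use assms that in auto)
  then have "expressible M n (\<lambda>e. \<forall>i\<in>{..<m}. e ! i = e ! (m + i))"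
    by (intro expressible_ball) auto
  then show ?thesis
    by (rule expressible_cong) (use assms in \<open>auto simp: list_eq_iff_nth_eq\<close>)
qed

lemma nth_representation:
  assumes "set cs \<subseteq> set e"
  obtains js where "set js \<subseteq> {..<length e}" "cs = map ((!) e) js"
proof -
  from assms have "\<exists>js. set js \<subseteq> {..<length e} \<and> cs = map ((!) e) js"
  proof (induction cs)
    case (Cons c cs)
    then obtain js where "set js \<subseteq> {..<length e}" "cs = map ((!) e) js" by auto
    moreover obtain i where "i < length e" "c = e ! i"
      using Cons.prems by (auto simp: in_set_conv_nth)
    ultimately show ?case by (intro exI[of _ "i # js"]) auto
  qed simp
  with that show thesis by blast
qed

text \<open>
  The conjuncts may have different parameter tuples, so the conjunction has to be
  formed over their concatenation.
\<close>

lemma conjunction_with_parameters: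
  assumes "finite F"
  shows "\<exists>\<Phi> bs. set bs \<subseteq> (\<Union>(\<phi>, cs)\<in>F. set cs) \<and>
    (\<forall>x. length x = n \<longrightarrow> (sat M (x @ bs) \<Phi> \<longleftrightarrow> (\<forall>(\<phi>, cs)\<in>F. sat M (x @ cs) \<phi>)))"
  using assms
proof (induction F rule: finite_induct)
  case empty
  obtain \<Phi> where "\<forall>e. length e = n \<longrightarrow> sat M e \<Phi>"
    using expressible_True[of M n] by (auto simp: expressible_def)
  then show ?case by (intro exI[of _ \<Phi>] exI[of _ "[]"]) simp
next
  case (insert p F)
  obtain \<phi> cs where p: "p = (\<phi>, cs)" by (cases p)
  obtain \<Phi> bs where bs: "set bs \<subseteq> (\<Union>(\<phi>, cs)\<in>F. set cs)"
    "\<And>x. length x = n \<Longrightarrow> sat M (x @ bs) \<Phi> \<longleftrightarrow> (\<forall>(\<phi>, cs)\<in>F. sat M (x @ cs) \<phi>)"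
    using insert.IH by blast
  let ?n = "n + (length cs + length bs)"
  have "expressible M ?n (\<lambda>e. sat M (take n e @ take (length cs) (drop n e)) \<phi> \<and>
      sat M (take n e @ drop (n + length cs) e) \<Phi>)"
    by (intro expressible_conj expressible_sat selects_append[OF selects_take selects_block]
        selects_append[OF selects_take selects_drop]) auto
  then obtain \<Psi> where \<Psi>: "\<And>e. length e = ?n \<Longrightarrow>
      sat M e \<Psi> \<longleftrightarrow> sat M (take n e @ take (length cs) (drop n e)) \<phi> \<and>
        sat M (take n e @ drop (n + length cs) e) \<Phi>"
    by (auto simp: expressible_def)
  have "sat M (x @ cs @ bs) \<Psi> \<longleftrightarrow> (\<forall>(\<phi>, cs)\<in>insert p F. sat M (x @ cs) \<phi>)"
    if "length x = n" for x
    using \<Psi>[of "x @ cs @ bs"] bs(2)[OF that] that p by simp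
  then show ?case
    using bs(1) p by (intro exI[of _ \<Psi>] exI[of _ "cs @ bs"]) auto
qed

section \<open>Automorphisms and types in a monster model\<close>

lemma those_map_option: "those (map (\<lambda>x. map_option f (g x)) xs) = map_option (map f) (those (map g xs))"
  by (induction xs) (auto split: option.splits simp: option.map_comp comp_def)

lemma eval_automorphism:
  assumes "automorphism M \<sigma>"
  shows "eval M (map \<sigma> e) t = map_option \<sigma> (eval M e t)"
proof (induction t)
  case (Fn f ts)
  then have "map (eval M (map \<sigma> e)) ts = map (\<lambda>t. map_option \<sigma> (eval M e t)) ts"
    by (intro map_cong) auto
  then have "eval M (map \<sigma> e) (Fn f ts)
      = Option.bind (map_option (map \<sigma>) (those (map (eval M e) ts))) (fun_of M f)"
    by (simp only: eval.simps those_map_option)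
  also have "\<dots> = map_option \<sigma> (eval M e (Fn f ts))"
    using assms by (cases "those (map (eval M e) ts)") (simp_all add: automorphism_def)
  finally show ?case .
qed simp

lemma sat_automorphism:
  assumes "automorphism M \<sigma>"
  shows "sat M (map \<sigma> e) \<phi> \<longleftrightarrow> sat M e \<phi>"
proof (induction \<phi> arbitrary: e)
  case (Eq t u)
  have "inj \<sigma>" using assms by (auto simp: automorphism_def bij_is_inj)
  then show ?case
    by (auto simp: eval_automorphism[OF assms] dest: injD)
next
  case (Rel r ts)
  have "map (eval M (map \<sigma> e)) ts = map (\<lambda>t. map_option \<sigma> (eval M e t)) ts"
    by (simp add: eval_automorphism[OF assms])
  then have "sat M (map \<sigma> e) (Rel r ts) \<longleftrightarrow>
      (\<exists>xs. map_option (map \<sigma>) (those (map (eval M e) ts)) = Some xs \<and> rel_of M r xs)"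
    by (simp only: sat.simps those_map_option)
  also have "\<dots> \<longleftrightarrow> sat M e (Rel r ts)"
    using assms by (auto simp: automorphism_def)
  finally show ?case .
next
  case (Ex s \<phi>)
  have surj: "\<exists>y. x = \<sigma> y" for x
    using assms by (auto simp: automorphism_def dest: bij_is_surj surjD)
  have sort: "sort_of M (\<sigma> x) = sort_of M x" for x
    using assms by (simp add: automorphism_def)
  have "sat M (\<sigma> x # map \<sigma> e) \<phi> \<longleftrightarrow> sat M (x # e) \<phi>" for x
    using Ex.IH[of "x # e"] by simp
  then show ?case using surj sort by (metis sat.simps(5))
qed simp_all

lemma sorts_automorphism:
  assumes "automorphism M \<sigma>"
  shows "map (sort_of M) (map \<sigma> a) = map (sort_of M) a"
  using assms by (simp add: automorphism_def)

lemma length_tuples: "x \<in> tuples M ss \<Longrightarrow> length x = length ss"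
  by (auto simp: tuples_def)

lemma tuples_automorphism:
  assumes "automorphism M \<sigma>"
  shows "map \<sigma> a \<in> tuples M ss \<longleftrightarrow> a \<in> tuples M ss"
  using sorts_automorphism[OF assms, of a] by (simp add: tuples_def del: map_map)

lemma automorphism_inv:
  assumes "automorphism M \<sigma>"
  shows "automorphism M (inv \<sigma>)"
proof -
  have bij: "bij \<sigma>" using assms by (simp add: automorphism_def)
  then have \<sigma>: "\<sigma> (inv \<sigma> x) = x" "inv \<sigma> (\<sigma> x) = x" for x
    by (simp_all add: bij_is_surj surj_f_inv_f bij_is_inj inv_f_f)
  have map: "map \<sigma> (map (inv \<sigma>) xs) = xs" for xs
    by (simp add: comp_def \<sigma>)
  have "fun_of M f (map (inv \<sigma>) xs) = map_option (inv \<sigma>) (fun_of M f xs)" for f xs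
  proof -
    have "fun_of M f xs = map_option \<sigma> (fun_of M f (map (inv \<sigma>) xs))"
      using assms map by (metis automorphism_def)
    then show ?thesis by (simp add: option.map_comp comp_def \<sigma> option.map_ident)
  qed
  moreover have "rel_of M r (map (inv \<sigma>) xs) \<longleftrightarrow> rel_of M r xs" for r xs
    using assms map by (metis automorphism_def)
  moreover have "sort_of M (inv \<sigma> x) = sort_of M x" for x
    using assms \<sigma> by (metis automorphism_def)
  ultimately show ?thesis
    using bij by (simp add: automorphism_def bij_imp_bij_inv)
qed

lemma map_inv_automorphism:
  assumes "automorphism M \<sigma>"
  shows "map (inv \<sigma>) (map \<sigma> a) = a" "map \<sigma> (map (inv \<sigma>) a) = a"
proof -
  have "bij \<sigma>" using assms by (simp add: automorphism_def)
  then show "map (inv \<sigma>) (map \<sigma> a) = a" "map \<sigma> (map (inv \<sigma>) a) = a"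
    by (simp_all add: comp_def bij_is_surj surj_f_inv_f bij_is_inj inv_f_f)
qed

lemma map_fixed:
  assumes "set bs \<subseteq> A" "\<forall>x\<in>A. \<sigma> x = x"
  shows "map \<sigma> bs = bs"
  using assms by (auto intro: map_idI)

lemma tp_eq_iff:
  "tp M A a = tp M B b \<longleftrightarrow> map (sort_of M) a = map (sort_of M) b \<and>
     (\<forall>\<phi> bs. (set bs \<subseteq> A \<and> sat M (a @ bs) \<phi>) \<longleftrightarrow> (set bs \<subseteq> B \<and> sat M (b @ bs) \<phi>))"
  by (auto simp: tp_def set_eq_iff)

lemma tp_eqI:
  assumes "map (sort_of M) a = map (sort_of M) b"
    "\<And>\<phi> bs. set bs \<subseteq> A \<Longrightarrow> sat M (a @ bs) \<phi> \<Longrightarrow> sat M (b @ bs) \<phi>"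
  shows "tp M A a = tp M A b"
proof -
  have "sat M (b @ bs) \<phi> \<Longrightarrow> sat M (a @ bs) \<phi>" if "set bs \<subseteq> A" for \<phi> bs
    using assms(2)[OF that, of "Neg \<phi>"] by auto
  then show ?thesis using assms by (auto simp: tp_eq_iff)
qed

lemma tp_eqD:
  assumes "tp M A a = tp M A b"
  shows "map (sort_of M) a = map (sort_of M) b" "length a = length b"
    "set bs \<subseteq> A \<Longrightarrow> sat M (a @ bs) \<phi> \<longleftrightarrow> sat M (b @ bs) \<phi>"
proof -
  show "map (sort_of M) a = map (sort_of M) b" using assms by (simp add: tp_eq_iff)
  then show "length a = length b" by (metis length_map)
  show "set bs \<subseteq> A \<Longrightarrow> sat M (a @ bs) \<phi> \<longleftrightarrow> sat M (b @ bs) \<phi>"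
    using assms by (auto simp: tp_eq_iff)
qed

lemma tp_mono:
  assumes "tp M B a = tp M B b" "A \<subseteq> B"
  shows "tp M A a = tp M A b"
  by (rule tp_eqI) (use assms tp_eqD in blast)+

lemma realizations_tp: "b \<in> realizations M (tp M A a) \<longleftrightarrow> tp M A b = tp M A a"
proof
  assume b: "b \<in> realizations M (tp M A a)"
  show "tp M A b = tp M A a"
    by (rule tp_eqI[symmetric]) (use b in \<open>auto simp: realizations_def tp_def tuples_def\<close>)
next
  assume "tp M A b = tp M A a"
  then show "b \<in> realizations M (tp M A a)"
    by (auto simp: realizations_def tp_eq_iff tuples_def tp_def)
qed

lemma complete_type_tp: "complete_type M A (tp M A a)"
proof -
  have "a \<in> realizations M (fst (tp M A a), F)" if "F \<subseteq> snd (tp M A a)" for F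
    using that by (auto simp: realizations_def tp_def tuples_def)
  then show ?thesis
    unfolding complete_type_def partial_type_def by (auto simp: tp_def)
qed

lemma tp_realization:
  assumes "complete_type M A p" "a \<in> realizations M p"
  shows "tp M A a = p"
proof (rule prod_eqI)
  show "fst (tp M A a) = fst p"
    using assms(2) by (simp add: tp_def realizations_def tuples_def)
  show "snd (tp M A a) = snd p"
  proof (intro set_eqI iffI; clarify)
    fix \<phi> bs assume *: "(\<phi>, bs) \<in> snd (tp M A a)"
    then have "(Neg \<phi>, bs) \<notin> snd p"
      using assms(2) by (fastforce simp: tp_def realizations_def)
    then show "(\<phi>, bs) \<in> snd p"
      using assms(1) * by (auto simp: complete_type_def tp_def)
  next
    fix \<phi> bs assume *: "(\<phi>, bs) \<in> snd p"
    then show "(\<phi>, bs) \<in> snd (tp M A a)"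
      using assms by (auto simp: complete_type_def partial_type_def tp_def realizations_def)
  qed
qed

lemma tp_automorphism:
  assumes "automorphism M \<sigma>" "tp M A a = tp M A b"
  shows "tp M (\<sigma> ` A) (map \<sigma> a) = tp M (\<sigma> ` A) (map \<sigma> b)"
proof (rule tp_eqI)
  show "map (sort_of M) (map \<sigma> a) = map (sort_of M) (map \<sigma> b)"
    using tp_eqD(1)[OF assms(2)] sorts_automorphism[OF assms(1)] by (simp del: map_map)
next
  fix \<phi> bs assume bs: "set bs \<subseteq> \<sigma> ` A" and sat: "sat M (map \<sigma> a @ bs) \<phi>"
  define cs where "cs = map (inv_into A \<sigma>) bs"
  have cs: "bs = map \<sigma> cs" "set cs \<subseteq> A"
    using bs by (auto simp: cs_def subset_iff f_inv_into_f inv_into_into intro!: map_idI[symmetric])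
  with sat have "sat M (a @ cs) \<phi>"
    using sat_automorphism[OF assms(1), of "a @ cs" \<phi>] by simp
  then have "sat M (b @ cs) \<phi>" using tp_eqD(3)[OF assms(2) cs(2)] by simp
  then show "sat M (map \<sigma> b @ bs) \<phi>"
    using sat_automorphism[OF assms(1), of "b @ cs" \<phi>] cs by simp
qed

lemma tp_fixing_automorphism:
  assumes "automorphism M \<sigma>" "\<forall>x\<in>A. \<sigma> x = x"
  shows "tp M A (map \<sigma> a) = tp M A a"
proof (rule tp_eqI)
  show "map (sort_of M) (map \<sigma> a) = map (sort_of M) a"
    by (rule sorts_automorphism[OF assms(1)])
next
  fix \<phi> bs assume "set bs \<subseteq> A" "sat M (map \<sigma> a @ bs) \<phi>"
  then show "sat M (a @ bs) \<phi>"
    using sat_automorphism[OF assms(1), of "a @ bs" \<phi>] map_fixed[OF _ assms(2)] by simp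
qed

lemma definable_automorphism:
  assumes "definable M {} ss X" "automorphism M \<sigma>"
  shows "map \<sigma> x \<in> X \<longleftrightarrow> x \<in> X"
  using assms(1) sat_automorphism[OF assms(2), of x] tuples_automorphism[OF assms(2), of x]
  by (auto simp: definable_def)

lemma realizations_automorphism:
  assumes "partial_type M {} p" "automorphism M \<sigma>"
  shows "map \<sigma> x \<in> realizations M p \<longleftrightarrow> x \<in> realizations M p"
proof -
  have "bs = []" if "(\<phi>, bs) \<in> snd p" for \<phi> bs
    using assms(1) that by (auto simp: partial_type_def)
  then show ?thesis
    using sat_automorphism[OF assms(2), of x] tuples_automorphism[OF assms(2), of x]
    by (fastforce simp: realizations_def)
qed

lemma definable_fun_automorphism:
  assumes "definable_fun M {} ss ts f" "automorphism M \<sigma>" "f x = Some y"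
  shows "f (map \<sigma> x) = Some (map \<sigma> y)"
proof -
  have "definable M {} (ss @ ts) {x @ y | x y. f x = Some y}"
    using assms(1) by (simp add: definable_fun_def)
  from definable_automorphism[OF this assms(2), of "x @ y"]
  have "map \<sigma> (x @ y) \<in> {x @ y | x y. f x = Some y}"
    using assms(3) by blast
  then obtain x' y' where *: "map \<sigma> x @ map \<sigma> y = x' @ y'" "f x' = Some y'"
    by auto
  have "x' \<in> tuples M ss" "x \<in> tuples M ss"
    using assms * by (auto simp: definable_fun_def)
  then have "length x' = length x" by (metis (mono_tags) length_map mem_Collect_eq tuples_def)
  with * show ?thesis by auto
qed

lemma dcl_fixed:
  assumes "a \<in> dcl M A" "automorphism M \<sigma>" "\<forall>x\<in>A. \<sigma> x = x"
  shows "\<sigma> a = a"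
proof -
  obtain \<phi> bs where \<phi>: "set bs \<subseteq> A" "{x. sort_of M x = sort_of M a \<and> sat M (x # bs) \<phi>} = {a}"
    using assms(1) by (auto simp: dcl_def)
  then have "sat M (\<sigma> a # bs) \<phi>"
    using sat_automorphism[OF assms(2), of "a # bs" \<phi>] map_fixed[OF \<phi>(1) assms(3)] by auto
  moreover have "sort_of M (\<sigma> a) = sort_of M a"
    using assms(2) by (simp add: automorphism_def)
  ultimately show ?thesis using \<phi>(2) by blast
qed

lemma dcl_automorphism:
  assumes "a \<in> dcl M A" "automorphism M \<sigma>"
  shows "\<sigma> a \<in> dcl M (\<sigma> ` A)"
proof -
  obtain \<phi> bs where \<phi>: "set bs \<subseteq> A" "{x. sort_of M x = sort_of M a \<and> sat M (x # bs) \<phi>} = {a}"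
    using assms(1) by (auto simp: dcl_def)
  have unique: "x = \<sigma> a" if "sort_of M x = sort_of M a" "sat M (x # map \<sigma> bs) \<phi>" for x
  proof -
    have "bij \<sigma>" using assms(2) by (simp add: automorphism_def)
    then obtain y where y: "x = \<sigma> y" by (metis bij_pointE)
    have "sort_of M y = sort_of M a"
      using that(1) y assms(2) by (simp add: automorphism_def)
    moreover have "sat M (y # bs) \<phi>"
      using that(2) y sat_automorphism[OF assms(2), of "y # bs" \<phi>] by simp
    ultimately show ?thesis using \<phi>(2) y by auto
  qed
  have sort: "sort_of M (\<sigma> a) = sort_of M a"
    using assms(2) by (simp add: automorphism_def)
  have "sat M (a # bs) \<phi>" using \<phi>(2) by blast
  then have sat: "sat M (\<sigma> a # map \<sigma> bs) \<phi>"
    using sat_automorphism[OF assms(2), of "a # bs" \<phi>] by simp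
  have "{x. sort_of M x = sort_of M (\<sigma> a) \<and> sat M (x # map \<sigma> bs) \<phi>} = {\<sigma> a}"
    unfolding sort using unique sort sat by blast
  moreover have "set (map \<sigma> bs) \<subseteq> \<sigma> ` A" using \<phi>(1) by auto
  ultimately show ?thesis unfolding dcl_def by blast
qed

text \<open>
  Hence a cardinal exceeding the number of formulas is infinite, and finite sets are small.
\<close>

lemma infinite_formulas: "infinite (UNIV :: ('f, 'r, 's) fm set)"
proof -
  define f :: "nat \<Rightarrow> ('f, 'r, 's) fm" where "f n = (Neg ^^ n) (Eq (Var 0) (Var 0))" for n
  have "size (f n) = n + size (f 0)" for n
    by (induction n) (simp_all add: f_def)
  then have "inj f" by (intro injI) (metis add_right_cancel)
  then have "infinite (range f)" by (simp add: finite_image_iff)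
  then show ?thesis by (rule infinite_super[rotated]) simp
qed

locale monster_model =
  fixes \<kappa> :: "'k rel" and M :: "('f, 'r, 's, 'm) model"
  assumes monster: "monster \<kappa> M"
begin

lemma Card_order_\<kappa>: "Card_order \<kappa>"
  using monster by (simp add: monster_def)

lemma infinite_Field_\<kappa>: "infinite (Field \<kappa>)"
proof -
  have "|UNIV :: ('f, 'r, 's) fm set| \<le>o |Field \<kappa>|"
    using monster by (auto simp: monster_def intro: ordLess_imp_ordLeq
        ordLess_ordIso_trans ordIso_symmetric[OF card_of_Field_ordIso])
  then show ?thesis using infinite_formulas card_of_ordLeq_infinite by blast
qed

lemma small_Un: "small \<kappa> (A \<union> B) \<longleftrightarrow> small \<kappa> A \<and> small \<kappa> B"
proof
  assume "small \<kappa> (A \<union> B)"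
  then show "small \<kappa> A \<and> small \<kappa> B"
    by (meson card_of_mono1 inf_sup_ord(3,4) ordLeq_ordLess_trans small_def)
next
  assume "small \<kappa> A \<and> small \<kappa> B"
  then show "small \<kappa> (A \<union> B)"
    unfolding small_def
    using card_of_Un_ordLess_infinite_Field[OF infinite_Field_\<kappa> Card_order_\<kappa>] by blast
qed

lemma small_finite:
  assumes "finite A"
  shows "small \<kappa> A"
proof -
  have "|A| <o |Field \<kappa>|"
    using assms infinite_Field_\<kappa> by (intro finite_ordLess_infinite card_of_Well_order) (simp_all add: Field_card_of)
  then show ?thesis
    unfolding small_def
    using card_of_Field_ordIso[OF Card_order_\<kappa>] ordLess_ordIso_trans by blast
qed

lemma realized:
  assumes "partial_type M A p" "small \<kappa> A"
  obtains a where "a \<in> realizations M p"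
  using assms monster unfolding monster_def saturated_def by (metis all_not_in_conv)

text \<open>
  Strong homogeneity speaks of maps on sets.  A tuple \<open>a\<close> may have repeated entries and
  entries in \<open>A\<close>; equality of types makes the assignment \<open>a \<mapsto> b\<close>, extended by the identity
  on \<open>A\<close>, a well-defined map all the same.
\<close>

lemma conjugate:
  assumes "small \<kappa> A" "tp M A a = tp M A b"
  obtains \<sigma> where "automorphism M \<sigma>" "\<forall>x\<in>A. \<sigma> x = x" "map \<sigma> a = b"
proof -
  note len = tp_eqD(2)[OF assms(2)]
  have eq: "a ! i = x \<longleftrightarrow> b ! i = x" if "i < length a" "x \<in> A" for i x
    using tp_eqD(3)[OF assms(2), of "[x]" "Eq (Var i) (Var (length a))"] that len
    by (auto simp: nth_append)
  have eq': "a ! i = a ! j \<longleftrightarrow> b ! i = b ! j" if "i < length a" "j < length a" for i j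
    using tp_eqD(3)[OF assms(2), of "[]" "Eq (Var i) (Var j)"] that len
    by (simp add: nth_append) metis
  define f where
    "f x = (if x \<in> A then x else b ! (SOME i. i < length a \<and> a ! i = x))" for x
  have fA: "\<forall>x\<in>A. f x = x" by (simp add: f_def)
  have fa: "f (a ! i) = b ! i" if i: "i < length a" for i
  proof (cases "a ! i \<in> A")
    case True
    then show ?thesis using eq[OF i True] by (simp add: f_def)
  next
    case False
    define j where "j = (SOME j. j < length a \<and> a ! j = a ! i)"
    have "j < length a \<and> a ! j = a ! i"
      unfolding j_def by (rule someI[of _ i]) (simp add: i)
    then have "b ! j = b ! i" using eq'[of j i] i by blast
    moreover have "f (a ! i) = b ! j" using False by (simp only: f_def j_def if_False)
    ultimately show ?thesis by simp
  qed
  have fab: "map f a = b"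
    using fa len by (intro nth_equalityI) auto
  have sorts: "sort_of M (f x) = sort_of M x" if x: "x \<in> A \<union> set a" for x
  proof (cases "x \<in> A")
    case False
    then obtain i where "i < length a" "a ! i = x" using x by (auto simp: in_set_conv_nth)
    then show ?thesis using fa len tp_eqD(1)[OF assms(2)] by (metis nth_map)
  qed (simp add: f_def)
  have elementary: "sat M (map f cs) \<phi> \<longleftrightarrow> sat M cs \<phi>" if cs: "set cs \<subseteq> A \<union> set a" for \<phi> cs
  proof -
    define bs where "bs = filter (\<lambda>x. x \<in> A) cs"
    have bs: "set bs \<subseteq> A" by (auto simp: bs_def)
    have "set cs \<subseteq> set (a @ bs)" using cs by (auto simp: bs_def)
    then obtain js where js: "set js \<subseteq> {..<length (a @ bs)}" "cs = map ((!) (a @ bs)) js"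
      by (rule nth_representation)
    have "map f (a @ bs) = b @ bs"
      using fab map_fixed[OF bs fA] by simp
    then have mapf: "map f cs = map ((!) (b @ bs)) js"
      using js by (auto simp: nth_map[symmetric] subset_iff simp del: nth_map)
    have js': "set js \<subseteq> {..<length (b @ bs)}" using js len by simp
    have "sat M cs \<phi> \<longleftrightarrow> sat M (a @ bs) (ren_fm (length (a @ bs)) js \<phi>)"
      by (simp only: sat_ren_fm[OF js(1)] js(2))
    also have "\<dots> \<longleftrightarrow> sat M (b @ bs) (ren_fm (length (b @ bs)) js \<phi>)"
      using tp_eqD(3)[OF assms(2) bs] len by simp
    also have "\<dots> \<longleftrightarrow> sat M (map f cs) \<phi>"
      by (simp only: sat_ren_fm[OF js'] mapf)
    finally show ?thesis by simp
  qed
  have small: "small \<kappa> (A \<union> set a)"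
    using assms(1) by (simp add: small_finite small_Un)
  have "strongly_homogeneous \<kappa> M" using monster by (simp add: monster_def)
  then have "\<exists>\<sigma>. automorphism M \<sigma> \<and> (\<forall>x\<in>A \<union> set a. \<sigma> x = f x)"
    unfolding strongly_homogeneous_def
    by (elim allE[of _ "A \<union> set a"] allE[of _ f] mp) (use small sorts elementary in blast)
  then obtain \<sigma> where \<sigma>: "automorphism M \<sigma>" "\<forall>x\<in>A \<union> set a. \<sigma> x = f x"
    by blast
  then have "map \<sigma> a = map f a" by simp
  with \<sigma> fA fab that show thesis by simp
qed

text \<open>
  If \<open>{b}\<close> were not isolated by any formula over \<open>A\<close>, then the type of \<open>b\<close> over \<open>A\<close> together with
  \<open>x \<noteq> b\<close> would be consistent, and a realization would be a nontrivial conjugate of \<open>b\<close>.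
\<close>

lemma fixed_imp_definable:
  assumes "small \<kappa> A"
    and fixed: "\<And>\<sigma>. automorphism M \<sigma> \<Longrightarrow> \<forall>x\<in>A. \<sigma> x = x \<Longrightarrow> map \<sigma> b = b"
  shows "definable M A (map (sort_of M) b) {b}"
proof -
  let ?ss = "map (sort_of M) b"
  let ?n = "length b"
  obtain \<delta> where \<delta>: "\<And>e. length e = 2 * ?n \<Longrightarrow> sat M e \<delta> \<longleftrightarrow> take ?n e \<noteq> take ?n (drop ?n e)"
    using expressible_not[OF expressible_eq[of ?n "2 * ?n" M]] by (auto simp: expressible_def)
  have \<delta>: "sat M (y @ b) \<delta> \<longleftrightarrow> y \<noteq> b" if "y \<in> tuples M ?ss" for y
  proof -
    have "length y = ?n" using length_tuples[OF that] by simp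
    then show ?thesis using \<delta>[of "y @ b"] by simp
  qed
  define p where "p = (?ss, insert (\<delta>, b) (snd (tp M A b)))"
  have "\<not> partial_type M (A \<union> set b) p"
  proof
    assume "partial_type M (A \<union> set b) p"
    moreover have "small \<kappa> (A \<union> set b)" using assms(1) by (simp add: small_finite small_Un)
    ultimately obtain y where y: "y \<in> realizations M p" by (rule realized)
    then have "tp M A y = tp M A b" "y \<noteq> b"
      using \<delta> realizations_tp[of y M A b] by (auto simp: p_def realizations_def tp_def)
    then obtain \<sigma> where "automorphism M \<sigma>" "\<forall>x\<in>A. \<sigma> x = x" "map \<sigma> b = y"
      using conjugate[OF assms(1), of b y] by metis
    with fixed \<open>y \<noteq> b\<close> show False by metis
  qed
  then obtain F where F: "F \<subseteq> snd p" "finite F" "realizations M (?ss, F) = {}"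
    by (auto simp: partial_type_def p_def tp_def)
  define F' where "F' = F - {(\<delta>, b)}"
  have F': "finite F'" "F' \<subseteq> snd (tp M A b)" using F by (auto simp: F'_def p_def)
  obtain \<Phi> bs where bs: "set bs \<subseteq> (\<Union>(\<phi>, cs)\<in>F'. set cs)"
    "\<And>x. length x = ?n \<Longrightarrow> sat M (x @ bs) \<Phi> \<longleftrightarrow> (\<forall>(\<phi>, cs)\<in>F'. sat M (x @ cs) \<phi>)"
    using conjunction_with_parameters[OF F'(1), of ?n M] by blast
  have "set bs \<subseteq> A" using bs(1) F'(2) by (fastforce simp: tp_def)
  moreover have "sat M (b @ bs) \<Phi>" using bs(2)[of b] F'(2) by (auto simp: tp_def)
  moreover have "y = b" if y: "y \<in> tuples M ?ss" "sat M (y @ bs) \<Phi>" for y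
  proof (rule ccontr)
    assume "y \<noteq> b"
    then have "sat M (y @ b) \<delta>" using \<delta>[OF y(1)] by simp
    moreover have "length y = ?n" using length_tuples[OF y(1)] by simp
    then have "\<forall>(\<phi>, cs)\<in>F'. sat M (y @ cs) \<phi>" using bs(2)[of y] y(2) by simp
    ultimately have "y \<in> realizations M (?ss, F)"
      using y(1) by (auto simp: realizations_def F'_def)
    with F(3) show False by simp
  qed
  moreover have "b \<in> tuples M ?ss" by (simp add: tuples_def)
  ultimately show ?thesis unfolding definable_def by blast
qed

lemma fixed_imp_dcl:
  assumes "small \<kappa> A"
    and fixed: "\<And>\<sigma>. automorphism M \<sigma> \<Longrightarrow> \<forall>x\<in>A. \<sigma> x = x \<Longrightarrow> \<sigma> a = a"
  shows "a \<in> dcl M A"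
proof -
  obtain \<phi> bs where \<phi>: "set bs \<subseteq> A" "{[a]} = {y \<in> tuples M [sort_of M a]. sat M (y @ bs) \<phi>}"
    using fixed_imp_definable[OF assms(1), of "[a]"] fixed by (auto simp: definable_def)
  have "x = a \<longleftrightarrow> sort_of M x = sort_of M a \<and> sat M (x # bs) \<phi>" for x
  proof -
    have "[x] \<in> {[a]} \<longleftrightarrow> [x] \<in> tuples M [sort_of M a] \<and> sat M ([x] @ bs) \<phi>"
      by (subst \<phi>(2)) simp
    then show ?thesis by (simp add: tuples_def)
  qed
  then have "{x. sort_of M x = sort_of M a \<and> sat M (x # bs) \<phi>} = {a}" by blast
  with \<phi>(1) show ?thesis unfolding dcl_def by blast
qed

end

section \<open>Dividing by compactness\<close>

text \<open>
  A finite piece of the sequences that witness dividing.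
\<close>

definition k_inconsistent ::
  "('f, 'r, 's, 'm) model \<Rightarrow> 's list \<Rightarrow> ('f, 'r, 's) fm \<Rightarrow> nat \<Rightarrow> 'm list list \<Rightarrow> bool" where
  "k_inconsistent M ss \<phi> k ds \<longleftrightarrow>
     (\<forall>I \<subseteq> {..<length ds}. card I = k \<longrightarrow> \<not> (\<exists>x \<in> tuples M ss. \<forall>i\<in>I. sat M (x @ ds ! i) \<phi>))"

text \<open>
  The sequence \<open>ds\<close> can be prolonged by \<open>N\<close> realizations of \<open>\<chi>(x, cs)\<close> without losing
  \<open>k\<close>-inconsistency.  New terms are put in front, because that is where an existential quantifier
  puts its witness in the environment.
\<close>

primrec extendable ::
  "('f, 'r, 's, 'm) model \<Rightarrow> 's list \<Rightarrow> ('f, 'r, 's) fm \<Rightarrow> nat \<Rightarrow> 's list \<Rightarrow>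
   ('f, 'r, 's) fm \<Rightarrow> 'm list \<Rightarrow> nat \<Rightarrow> 'm list list \<Rightarrow> bool" where
  "extendable M ss \<phi> k ts \<chi> cs 0 ds \<longleftrightarrow> k_inconsistent M ss \<phi> k ds"
| "extendable M ss \<phi> k ts \<chi> cs (Suc N) ds \<longleftrightarrow>
     (\<exists>e \<in> tuples M ts. sat M (e @ cs) \<chi> \<and> extendable M ss \<phi> k ts \<chi> cs N (e # ds))"

text \<open>
  An environment codes a finite sequence of \<open>m\<close>-tuples by their concatenation.
\<close>

definition blocks :: "nat \<Rightarrow> nat \<Rightarrow> 'm list \<Rightarrow> 'm list list" where
  "blocks n m e = map (\<lambda>i. take m (drop (i * m) e)) [0..<n]"

lemma blocks_append: "length x = m \<Longrightarrow> blocks (Suc n) m (x @ e) = x # blocks n m e"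
  unfolding blocks_def by (simp add: upt_conv_Cons map_Suc_upt[symmetric] comp_def del: upt_Suc)

lemma blocks_concat:
  "\<forall>d\<in>set ds. length d = m \<Longrightarrow> blocks (length ds) m (concat ds @ e) = ds"
proof (induction ds)
  case (Cons d ds)
  then show ?case using blocks_append[of d m "length ds" "concat ds @ e"] by simp
qed (simp add: blocks_def)

lemma length_concat_blocks: "\<forall>d\<in>set ds. length d = m \<Longrightarrow> length (concat ds) = length ds * m"
  by (induction ds) auto

lemma k_inconsistent_Cons:
  assumes "k_inconsistent M ss \<phi> k (d # ds)"
  shows "k_inconsistent M ss \<phi> k ds"
  unfolding k_inconsistent_def
proof (intro allI impI)
  fix I assume I: "I \<subseteq> {..<length ds}" "card I = k"
  have "card (Suc ` I) = k" using I by (simp add: card_image)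
  moreover have "Suc ` I \<subseteq> {..<length (d # ds)}" using I by auto
  ultimately have "\<not> (\<exists>x\<in>tuples M ss. \<forall>i\<in>Suc ` I. sat M (x @ (d # ds) ! i) \<phi>)"
    using assms unfolding k_inconsistent_def by blast
  then show "\<not> (\<exists>x\<in>tuples M ss. \<forall>i\<in>I. sat M (x @ ds ! i) \<phi>)"
    by simp
qed

lemma extendable_Suc:
  "extendable M ss \<phi> k ts \<chi> cs (Suc N) ds \<Longrightarrow> extendable M ss \<phi> k ts \<chi> cs N ds"
proof (induction N arbitrary: ds)
  case 0
  then show ?case using k_inconsistent_Cons by auto
next
  case (Suc N)
  then show ?case by (metis extendable.simps(2))
qed

lemma extendable_mono:
  assumes "extendable M ss \<phi> k ts \<chi> cs N ds" "N' \<le> N"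
    and "\<And>x. x \<in> tuples M ts \<Longrightarrow> sat M (x @ cs) \<chi> \<Longrightarrow> sat M (x @ cs') \<chi>'"
  shows "extendable M ss \<phi> k ts \<chi>' cs' N' ds"
proof -
  have "extendable M ss \<phi> k ts \<chi> cs N' ds"
    using assms(2,1) by (induction rule: dec_induct) (auto dest: extendable_Suc simp del: extendable.simps)
  then show ?thesis
    by (induction N' arbitrary: ds) (use assms(3) in auto)
qed

lemma extendable_intro:
  assumes "\<forall>e\<in>set es. e \<in> tuples M ts \<and> sat M (e @ cs) \<chi>" "k_inconsistent M ss \<phi> k (es @ ds)"
  shows "extendable M ss \<phi> k ts \<chi> cs (length es) ds"
  using assms by (induction es arbitrary: ds rule: rev_induct) auto

lemma expressible_extendable:
  "expressible M (n * length ts + l)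
     (\<lambda>e. extendable M ss \<phi> k ts \<chi> (drop (n * length ts) e) N (blocks n (length ts) e))"
proof (induction N arbitrary: n)
  case 0
  let ?m = "length ts"
  have "expressible M (n * ?m + l) (\<lambda>e. \<forall>I\<in>{I. I \<subseteq> {..<n} \<and> card I = k}.
      \<not> (\<exists>x\<in>tuples M ss. \<forall>i\<in>I. sat M (take (length ss) (x @ e)
            @ take ?m (drop (length ss + i * ?m) (x @ e))) \<phi>))"
  proof (intro expressible_ball expressible_not expressible_ex expressible_sat)
    fix I i assume "I \<in> {I. I \<subseteq> {..<n} \<and> card I = k}" "i \<in> I"
    then have "Suc i \<le> n" by auto
    then have "Suc i * ?m \<le> n * ?m" by (rule mult_le_mono1)
    then show "selects (length ss + (n * ?m + l)) (length ss + ?m)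
        (\<lambda>e. take (length ss) e @ take ?m (drop (length ss + i * ?m) e))"
      by (intro selects_append[OF selects_take selects_block]) auto
  qed (auto intro: finite_subset)
  then show ?case
    by (rule expressible_cong)
      (auto simp: k_inconsistent_def blocks_def length_tuples subset_iff nth_map)
next
  case (Suc N)
  let ?m = "length ts"
  have "expressible M (?m + (n * ?m + l)) (\<lambda>e. sat M (take ?m e @ drop (?m + n * ?m) e) \<chi>)"
    by (intro expressible_sat selects_append[OF selects_take selects_drop]) auto
  moreover have "expressible M (?m + (n * ?m + l)) (\<lambda>e.
      extendable M ss \<phi> k ts \<chi> (drop (Suc n * ?m) e) N (blocks (Suc n) ?m e))"
    using Suc.IH[of "Suc n"] by (simp add: add.assoc)
  ultimately have "expressible M (n * ?m + l) (\<lambda>e. \<exists>x\<in>tuples M ts.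
      sat M (take ?m (x @ e) @ drop (?m + n * ?m) (x @ e)) \<chi> \<and>
      extendable M ss \<phi> k ts \<chi> (drop (Suc n * ?m) (x @ e)) N (blocks (Suc n) ?m (x @ e)))"
    by (intro expressible_ex expressible_conj)
  then show ?case
  proof (rule expressible_cong)
    fix e :: "'d list"
    show "(\<exists>x\<in>tuples M ts. sat M (take ?m (x @ e) @ drop (?m + n * ?m) (x @ e)) \<chi> \<and>
        extendable M ss \<phi> k ts \<chi> (drop (Suc n * ?m) (x @ e)) N (blocks (Suc n) ?m (x @ e)))
      \<longleftrightarrow> extendable M ss \<phi> k ts \<chi> (drop (n * ?m) e) (Suc N) (blocks n ?m e)"
      by (simp add: length_tuples blocks_append cong: bex_cong)
  qed
qed

context monster_model
begin

text \<open>
  An infinite sequence cannot be realized at once, since a type has only finitely many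
  variables.  It is built one term at a time: the invariant \<open>good\<close> says that the terms found so far
  can be prolonged by any finite number of realizations of any formula in the type of \<open>b\<close> over \<open>C\<close>.
  The demands on the next term are finitely satisfiable, because finitely many of them are implied by a single one,
  for the conjunction of the formulas and the largest of the lengths.
\<close>

lemma divides_by_compactness:
  assumes "small \<kappa> C"
    and ext: "\<And>\<chi> cs N. set cs \<subseteq> C \<Longrightarrow> sat M (b @ cs) \<chi> \<Longrightarrow>
      extendable M ss \<phi> k (map (sort_of M) b) \<chi> cs N []"
  shows "divides M C ss \<phi> b"
proof -
  let ?ts = "map (sort_of M) b"
  define good where "good ds \<longleftrightarrow> (\<forall>d\<in>set ds. d \<in> tuples M ?ts) \<and>
    (\<forall>\<chi> cs N. set cs \<subseteq> C \<longrightarrow> sat M (b @ cs) \<chi> \<longrightarrow> extendable M ss \<phi> k ?ts \<chi> cs N ds)" for ds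
  have step: "\<exists>d. tp M C d = tp M C b \<and> good (d # ds)" if "good ds" for ds
  proof -
    \<comment> \<open>\<open>\<psi>\<close> expresses that \<open>x\<close> satisfies \<open>\<chi>\<close> and can be put in front of \<open>ds\<close>.\<close>
    define codes where "codes \<psi> \<chi> cs N \<longleftrightarrow> set cs \<subseteq> C \<and> sat M (b @ cs) \<chi> \<and>
      (\<forall>x\<in>tuples M ?ts. sat M (x @ concat ds @ cs) \<psi> \<longleftrightarrow>
        sat M (x @ cs) \<chi> \<and> extendable M ss \<phi> k ?ts \<chi> cs N (x # ds))" for \<psi> \<chi> cs N
    define \<Gamma> where "\<Gamma> = {(\<psi>, concat ds @ cs) | \<psi> \<chi> cs N. codes \<psi> \<chi> cs N}"
    have len: "\<forall>d\<in>set ds. length d = length b"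
      using that unfolding good_def by (metis length_map length_tuples)
    have code: "\<exists>\<psi>. codes \<psi> \<chi> cs N" if cs: "set cs \<subseteq> C" "sat M (b @ cs) \<chi>" for \<chi> cs N
    proof -
      let ?n = "length b + (length ds * length b + length cs)"
      have "expressible M ?n (\<lambda>e. sat M (take (length b) e @ drop (length b + length ds * length b) e) \<chi>)"
        by (intro expressible_sat selects_append[OF selects_take selects_drop]) auto
      moreover have "expressible M ?n (\<lambda>e. extendable M ss \<phi> k ?ts \<chi>
          (drop (Suc (length ds) * length ?ts) e) N (blocks (Suc (length ds)) (length ?ts) e))"
        using expressible_extendable[of M "Suc (length ds)" ?ts "length cs"] by (simp add: add.assoc)
      ultimately have "expressible M ?n (\<lambda>e.
          sat M (take (length b) e @ drop (length b + length ds * length b) e) \<chi> \<and>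
          extendable M ss \<phi> k ?ts \<chi>
          (drop (Suc (length ds) * length ?ts) e) N (blocks (Suc (length ds)) (length ?ts) e))"
        by (rule expressible_conj)
      then obtain \<psi> where \<psi>: "\<And>e. length e = ?n \<Longrightarrow> sat M e \<psi> \<longleftrightarrow>
          sat M (take (length b) e @ drop (length b + length ds * length b) e) \<chi> \<and>
          extendable M ss \<phi> k ?ts \<chi>
          (drop (Suc (length ds) * length ?ts) e) N (blocks (Suc (length ds)) (length ?ts) e)"
        by (auto simp: expressible_def)
      have "sat M (x @ concat ds @ cs) \<psi> \<longleftrightarrow>
        sat M (x @ cs) \<chi> \<and> extendable M ss \<phi> k ?ts \<chi> cs N (x # ds)" if "x \<in> tuples M ?ts" for x
        using \<psi>[of "x @ concat ds @ cs"] length_tuples[OF that] length_concat_blocks[OF len]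
        by (simp add: blocks_append blocks_concat[OF len] del: length_concat)
      with cs show ?thesis unfolding codes_def by blast
    qed
    have "realizations M (?ts, F) \<noteq> {}" if F: "F \<subseteq> \<Gamma>" "finite F" for F
    proof -
      have "\<forall>p\<in>F. \<exists>t. snd p = concat ds @ fst (snd t) \<and> codes (fst p) (fst t) (fst (snd t)) (snd (snd t))"
        using F(1) by (force simp: \<Gamma>_def)
      then obtain g where g: "\<And>p. p \<in> F \<Longrightarrow> snd p = concat ds @ fst (snd (g p)) \<and>
          codes (fst p) (fst (g p)) (fst (snd (g p))) (snd (snd (g p)))"
        by metis
      define F' where "F' = (\<lambda>p. (fst (g p), fst (snd (g p)))) ` F"
      have "finite F'" using F(2) by (simp add: F'_def)
      obtain \<Phi> bs where bs: "set bs \<subseteq> (\<Union>(\<phi>, cs)\<in>F'. set cs)"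
        "\<And>x. length x = length b \<Longrightarrow> sat M (x @ bs) \<Phi> \<longleftrightarrow> (\<forall>(\<phi>, cs)\<in>F'. sat M (x @ cs) \<phi>)"
        using conjunction_with_parameters[OF \<open>finite F'\<close>, of "length b" M] by blast
      have "set bs \<subseteq> C" using bs(1) g by (fastforce simp: F'_def codes_def)
      moreover have "sat M (b @ bs) \<Phi>" using bs(2)[of b] g by (auto simp: F'_def codes_def)
      \<comment> \<open>One more than the largest length demanded: the first of the \<open>Suc N\<close> new terms is the term sought.\<close>
      moreover define N where "N = Max (insert 0 ((\<lambda>p. snd (snd (g p))) ` F))"
      ultimately have "extendable M ss \<phi> k ?ts \<Phi> bs (Suc N) ds"
        using \<open>good ds\<close> unfolding good_def by blast
      then obtain e where e: "e \<in> tuples M ?ts" "sat M (e @ bs) \<Phi>"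
        "extendable M ss \<phi> k ?ts \<Phi> bs N (e # ds)" by auto
      have "sat M (e @ snd p) (fst p)" if p: "p \<in> F" for p
      proof -
        have imp: "sat M (x @ fst (snd (g p))) (fst (g p))"
          if "x \<in> tuples M ?ts" "sat M (x @ bs) \<Phi>" for x
          using bs(2)[of x] length_tuples[OF that(1)] that(2) p by (auto simp: F'_def)
        have "snd (snd (g p)) \<le> N" unfolding N_def using F(2) p by (intro Max_ge) auto
        with e imp have "extendable M ss \<phi> k ?ts (fst (g p)) (fst (snd (g p))) (snd (snd (g p))) (e # ds)"
          by (meson extendable_mono)
        then show ?thesis using g[OF p] e imp by (auto simp: codes_def)
      qed
      then have "e \<in> realizations M (?ts, F)" using e(1) by (auto simp: realizations_def)
      then show ?thesis by blast
    qed
    then have "partial_type M (set (concat ds) \<union> C) (?ts, \<Gamma>)"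
      by (auto simp: partial_type_def \<Gamma>_def codes_def)
    moreover have "small \<kappa> (set (concat ds) \<union> C)"
      using assms(1) small_finite[of "set (concat ds)"] small_Un by blast
    ultimately obtain d where d: "d \<in> realizations M (?ts, \<Gamma>)" by (rule realized)
    then have dt: "d \<in> tuples M ?ts" by (simp add: realizations_def)
    have *: "sat M (d @ cs) \<chi> \<and> extendable M ss \<phi> k ?ts \<chi> cs N (d # ds)"
      if "set cs \<subseteq> C" "sat M (b @ cs) \<chi>" for \<chi> cs N
    proof -
      obtain \<psi> where \<psi>: "codes \<psi> \<chi> cs N" using code \<open>set cs \<subseteq> C\<close> \<open>sat M (b @ cs) \<chi>\<close> by blast
      then have "(\<psi>, concat ds @ cs) \<in> \<Gamma>" by (auto simp: \<Gamma>_def)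
      then have "sat M (d @ concat ds @ cs) \<psi>" using d by (auto simp: realizations_def)
      then show ?thesis using \<psi> dt by (auto simp: codes_def)
    qed
    have "tp M C b = tp M C d"
      by (rule tp_eqI) (use dt * in \<open>auto simp: tuples_def\<close>)
    moreover have "good (d # ds)" using * dt \<open>good ds\<close> by (auto simp: good_def)
    ultimately show ?thesis by metis
  qed
  \<comment> \<open>\<open>f n\<close> consists of the first \<open>n\<close> terms, the latest in front, so its \<open>i\<close>-th entry is \<open>d (n - Suc i)\<close>.\<close>
  define f where "f = rec_nat [] (\<lambda>_ ds. (SOME d. tp M C d = tp M C b \<and> good (d # ds)) # ds)"
  define d where "d i = hd (f (Suc i))" for i
  have f0: "f 0 = []" by (simp add: f_def)
  have good: "good (f n)" for n
  proof (induction n)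
    case 0
    show ?case using ext by (simp add: good_def f0)
  next
    case (Suc n)
    from someI_ex[OF step[OF this]] show ?case by (simp add: f_def)
  qed
  have fSuc: "f (Suc n) = d n # f n" "tp M C (d n) = tp M C b" for n
    using someI_ex[OF step[OF good[of n]]] by (simp_all add: f_def d_def)
  have len: "length (f n) = n" for n
    by (induction n) (simp_all add: f0 fSuc)
  have nth: "f n ! i = d (n - Suc i)" if "i < n" for i n
    using that by (induction n arbitrary: i) (auto simp: fSuc nth_Cons' less_Suc_eq_0_disj)
  obtain \<tau> where \<tau>: "sat M (b @ []) \<tau>"
    using expressible_True[of M "length b"] by (auto simp: expressible_def)
  have inconsistent: "k_inconsistent M ss \<phi> k (f n)" for n
  proof -
    have "extendable M ss \<phi> k ?ts \<tau> [] 0 (f n)"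
      using good[of n] \<tau> unfolding good_def by (metis empty_set empty_subsetI)
    then show ?thesis by simp
  qed
  have "\<not> (\<exists>x\<in>tuples M ss. \<forall>i\<in>I. sat M (x @ d i) \<phi>)" if I: "finite I" "card I = k" for I
  proof
    assume "\<exists>x\<in>tuples M ss. \<forall>i\<in>I. sat M (x @ d i) \<phi>"
    then obtain x where x: "x \<in> tuples M ss" "\<forall>i\<in>I. sat M (x @ d i) \<phi>" by blast
    obtain n where n: "\<forall>i\<in>I. i < n" using I(1) finite_nat_set_iff_bounded by blast
    let ?J = "(\<lambda>i. n - Suc i) ` I"
    have "inj_on (\<lambda>i. n - Suc i) I"
      using n by (intro inj_onI) (metis Suc_diff_Suc diff_diff_cancel less_imp_le_nat nat.inject)
    then have "card ?J = k" using I(2) by (simp add: card_image)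
    moreover have "?J \<subseteq> {..<length (f n)}" using n by (auto simp: len)
    moreover have "\<forall>j\<in>?J. sat M (x @ f n ! j) \<phi>"
      using x(2) n nth by (auto simp: Suc_diff_Suc)
    ultimately show False
      using inconsistent[of n] x(1) unfolding k_inconsistent_def by blast
  qed
  with fSuc(2) show ?thesis unfolding divides_def by blast
qed

end

section \<open>Independence\<close>

lemma realizations_sat: "a \<in> realizations M p \<Longrightarrow> (\<phi>, b) \<in> snd p \<Longrightarrow> sat M (a @ b) \<phi>"
  by (auto simp: realizations_def)

lemma dividesI:
  fixes M :: "('f, 'r, 's, 'm) model" and d :: "nat \<Rightarrow> 'm list"
  assumes "\<And>i. tp M C (d i) = tp M C b"
    "\<And>I x. finite I \<Longrightarrow> card I = k \<Longrightarrow> x \<in> tuples M ss \<Longrightarrow> \<exists>i\<in>I. \<not> sat M (x @ d i) \<phi>"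
  shows "divides M C ss \<phi> b"
  unfolding divides_def by (intro exI[of _ d] exI[of _ k]) (use assms in auto)

lemma dividesE:
  fixes M :: "('f, 'r, 's, 'm) model"
  assumes "divides M C ss \<phi> b"
  obtains d :: "nat \<Rightarrow> 'm list" and k where "\<And>i. tp M C (d i) = tp M C b"
    "\<And>I x. finite I \<Longrightarrow> card I = k \<Longrightarrow> x \<in> tuples M ss \<Longrightarrow> \<exists>i\<in>I. \<not> sat M (x @ d i) \<phi>"
proof -
  from assms obtain d :: "nat \<Rightarrow> 'm list" and k where d: "\<forall>i. tp M C (d i) = tp M C b"
    and k: "\<forall>I. finite I \<and> card I = k \<longrightarrow> \<not> (\<exists>x\<in>tuples M ss. \<forall>i\<in>I. sat M (x @ d i) \<phi>)"
    unfolding divides_def by (elim exE conjE)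
  show thesis by (rule that[of d k]) (use d k in auto)
qed

lemma independent_not_divides:
  assumes "independent M C a B" "set b \<subseteq> B \<union> C" "sat M (a @ b) \<phi>"
  shows "\<not> divides M C (map (sort_of M) a) \<phi> b"
proof
  assume "divides M C (map (sort_of M) a) \<phi> b"
  then have "forks M C (tp M (B \<union> C) a)"
    unfolding forks_def using assms(2,3)
    by (intro exI[of _ "{(\<phi>, b)}"]) (auto simp: tp_def realizations_def)
  with assms(1) show False by (simp add: independent_def)
qed

lemma independent_subset:
  assumes "independent M C a B" "B' \<subseteq> B \<union> C"
  shows "independent M C a B'"
proof -
  have "realizations M (tp M (B \<union> C) a) \<subseteq> realizations M (tp M (B' \<union> C) a)"
    using assms(2) realizations_tp tp_mono by (metis Un_subset_iff Un_upper2 subsetI)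
  moreover have "fst (tp M (B' \<union> C) a) = fst (tp M (B \<union> C) a)" by (simp add: tp_def)
  ultimately have "forks M C (tp M (B' \<union> C) a) \<Longrightarrow> forks M C (tp M (B \<union> C) a)"
    unfolding forks_def by (auto 0 4)
  with assms(1) show ?thesis by (auto simp: independent_def)
qed

lemma divides_automorphism:
  fixes M :: "('f, 'r, 's, 'm) model"
  assumes "automorphism M \<sigma>" "divides M C ss \<phi> b"
  shows "divides M (\<sigma> ` C) ss \<phi> (map \<sigma> b)"
  using assms(2)
proof (rule dividesE)
  fix d :: "nat \<Rightarrow> 'm list" and k
  assume d: "\<And>i. tp M C (d i) = tp M C b"
    "\<And>I x. finite I \<Longrightarrow> card I = k \<Longrightarrow> x \<in> tuples M ss \<Longrightarrow> \<exists>i\<in>I. \<not> sat M (x @ d i) \<phi>"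
  show ?thesis
  proof (rule dividesI)
    show "tp M (\<sigma> ` C) (map \<sigma> (d i)) = tp M (\<sigma> ` C) (map \<sigma> b)" for i
      by (rule tp_automorphism[OF assms(1) d(1)])
  next
    fix I :: "nat set" and x assume I: "finite I" "card I = k" and x: "x \<in> tuples M ss"
    let ?x = "map (inv \<sigma>) x"
    have "?x \<in> tuples M ss"
      using x tuples_automorphism[OF automorphism_inv[OF assms(1)]] by blast
    then obtain i where i: "i \<in> I" "\<not> sat M (?x @ d i) \<phi>" using d(2)[OF I] by blast
    have "map \<sigma> (?x @ d i) = x @ map \<sigma> (d i)"
      by (simp only: map_append map_inv_automorphism[OF assms(1)])
    then have "\<not> sat M (x @ map \<sigma> (d i)) \<phi>"
      using i(2) sat_automorphism[OF assms(1), of "?x @ d i" \<phi>] by simp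
    with i(1) show "\<exists>i\<in>I. \<not> sat M (x @ map \<sigma> (d i)) \<phi>" by blast
  qed
qed

lemma independent_automorphism:
  assumes "automorphism M \<sigma>" "independent M C a B"
  shows "independent M (\<sigma> ` C) (map \<sigma> a) (\<sigma> ` B)"
  unfolding independent_def
proof
  let ?\<rho> = "inv \<sigma>"
  have \<rho>: "automorphism M ?\<rho>" by (rule automorphism_inv[OF assms(1)])
  have "inj \<sigma>" using assms(1) by (auto simp: automorphism_def bij_is_inj)
  then have image: "?\<rho> ` \<sigma> ` X = X" for X by (simp add: image_inv_f_f)
  assume "forks M (\<sigma> ` C) (tp M (\<sigma> ` B \<union> \<sigma> ` C) (map \<sigma> a))"
  then obtain D where D: "finite D"
    "\<And>\<phi> b. (\<phi>, b) \<in> D \<Longrightarrow> divides M (\<sigma> ` C) (fst (tp M (\<sigma> ` B \<union> \<sigma> ` C) (map \<sigma> a))) \<phi> b"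
    "\<And>x. x \<in> realizations M (tp M (\<sigma> ` B \<union> \<sigma> ` C) (map \<sigma> a)) \<Longrightarrow>
      \<exists>(\<phi>, b)\<in>D. sat M (x @ b) \<phi>"
    unfolding forks_def by blast
  define D' where "D' = (\<lambda>(\<phi>, b). (\<phi>, map ?\<rho> b)) ` D"
  have "fst (tp M (\<sigma> ` B \<union> \<sigma> ` C) (map \<sigma> a)) = fst (tp M (B \<union> C) a)"
    using sorts_automorphism[OF assms(1), of a] by (simp add: tp_def del: map_map)
  then have "divides M C (fst (tp M (B \<union> C) a)) \<phi> b" if "(\<phi>, b) \<in> D'" for \<phi> b
    using that divides_automorphism[OF \<rho> D(2)] by (auto simp: D'_def image)
  moreover have "\<exists>(\<phi>, b)\<in>D'. sat M (x @ b) \<phi>" if x: "x \<in> realizations M (tp M (B \<union> C) a)" for x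
  proof -
    have "tp M (\<sigma> ` (B \<union> C)) (map \<sigma> x) = tp M (\<sigma> ` (B \<union> C)) (map \<sigma> a)"
      using x realizations_tp tp_automorphism[OF assms(1)] by blast
    then have "map \<sigma> x \<in> realizations M (tp M (\<sigma> ` B \<union> \<sigma> ` C) (map \<sigma> a))"
      using realizations_tp by (metis image_Un)
    then obtain \<phi> b where b: "(\<phi>, b) \<in> D" "sat M (map \<sigma> x @ b) \<phi>" using D(3) by blast
    have "sat M (map ?\<rho> (map \<sigma> x @ b)) \<phi>" using b(2) sat_automorphism[OF \<rho>] by blast
    then have "sat M (x @ map ?\<rho> b) \<phi>"
      by (simp only: map_append map_inv_automorphism[OF assms(1)])
    then show ?thesis using b(1) by (force simp: D'_def)
  qed
  moreover have "finite D'" using D(1) by (simp add: D'_def)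
  ultimately have "forks M C (tp M (B \<union> C) a)" unfolding forks_def by blast
  with assms(2) show False by (simp add: independent_def)
qed

context monster_model
begin

text \<open>
  The extension has to avoid all formulas over \<open>E\<close> that fork, not only those that divide: a forking formula is
  covered by finitely many dividing ones, whose parameters may lie outside \<open>E\<close>.  If the type
  of \<open>a\<close> over \<open>B\<close> could not avoid them, it would be covered by finitely many forking formulas,
  hence by finitely many dividing ones.  Avoiding them suffices, because by compactness a complete
  type over \<open>E\<close> that forks contains a single formula that forks.
\<close>

lemma nonforking_extension:
  assumes "small \<kappa> E" "C \<subseteq> B" "B \<subseteq> E" "independent M C a B"
  obtains a' where "tp M B a' = tp M B a" "independent M C a' E"
proof -
  let ?ss = "map (sort_of M) a"
  define \<Gamma> where "\<Gamma> = {(Neg \<psi>, b) | \<psi> b. set b \<subseteq> E \<and> forks M C (?ss, {(\<psi>, b)})}"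
  have "realizations M (?ss, F) \<noteq> {}" if F: "F \<subseteq> snd (tp M B a) \<union> \<Gamma>" "finite F" for F
  proof
    assume empty: "realizations M (?ss, F) = {}"
    define G where "G = {(\<psi>, b). (Neg \<psi>, b) \<in> F \<inter> \<Gamma>}"
    have "G \<subseteq> (\<lambda>(\<psi>, b). (case \<psi> of Neg \<psi>' \<Rightarrow> \<psi>', b)) ` F" by (force simp: G_def)
    then have "finite G" using F(2) finite_surj by blast
    have "\<exists>D. finite D \<and> (\<forall>(\<phi>, b)\<in>D. divides M C ?ss \<phi> b) \<and>
        (\<forall>x\<in>realizations M (?ss, {p}). \<exists>(\<phi>, b)\<in>D. sat M (x @ b) \<phi>)" if "p \<in> G" for p
      using that by (cases p) (auto simp: G_def \<Gamma>_def forks_def)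
    then obtain D where D: "\<And>p. p \<in> G \<Longrightarrow> finite (D p) \<and> (\<forall>(\<phi>, b)\<in>D p. divides M C ?ss \<phi> b) \<and>
        (\<forall>x\<in>realizations M (?ss, {p}). \<exists>(\<phi>, b)\<in>D p. sat M (x @ b) \<phi>)"
      by metis
    have "\<exists>(\<phi>, b)\<in>\<Union> (D ` G). sat M (x @ b) \<phi>" if x: "x \<in> realizations M (tp M B a)" for x
    proof -
      have xt: "x \<in> tuples M ?ss" using x by (simp add: realizations_def tp_def)
      obtain \<theta> b where \<theta>: "(\<theta>, b) \<in> F" "\<not> sat M (x @ b) \<theta>"
        using empty xt by (auto simp: realizations_def)
      then have "(\<theta>, b) \<in> \<Gamma>" using F(1) x by (auto simp: realizations_def)
      then obtain \<psi> where \<psi>: "\<theta> = Neg \<psi>" by (auto simp: \<Gamma>_def)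
      then have "(\<psi>, b) \<in> G" using \<theta>(1) \<open>(\<theta>, b) \<in> \<Gamma>\<close> by (simp add: G_def)
      moreover have "x \<in> realizations M (?ss, {(\<psi>, b)})"
        using xt \<theta>(2) \<psi> by (simp add: realizations_def)
      ultimately have "\<exists>(\<phi>, b)\<in>D (\<psi>, b). sat M (x @ b) \<phi>" using D[of "(\<psi>, b)"] by blast
      with \<open>(\<psi>, b) \<in> G\<close> show ?thesis by blast
    qed
    moreover have "finite (\<Union> (D ` G))" using \<open>finite G\<close> D by blast
    moreover have "\<forall>(\<phi>, b)\<in>\<Union> (D ` G). divides M C (fst (tp M B a)) \<phi> b"
      using D by (fastforce simp: tp_def)
    ultimately have "forks M C (tp M B a)" unfolding forks_def by blast
    then show False using assms(2,4) by (simp add: independent_def Un_absorb2)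
  qed
  then have "partial_type M E (?ss, snd (tp M B a) \<union> \<Gamma>)"
    using assms(3) by (auto simp: partial_type_def tp_def \<Gamma>_def)
  then obtain a' where a': "a' \<in> realizations M (?ss, snd (tp M B a) \<union> \<Gamma>)"
    using assms(1) realized by blast
  then have "a' \<in> realizations M (tp M B a)" by (auto simp: realizations_def tp_def)
  then have tp: "tp M B a' = tp M B a" by (simp add: realizations_tp)
  have sorts: "map (sort_of M) a' = ?ss" using tp by (rule tp_eqD)
  have "\<not> forks M C (tp M E a')"
  proof
    assume "forks M C (tp M E a')"
    then obtain D where D: "finite D" "\<forall>(\<phi>, b)\<in>D. divides M C ?ss \<phi> b"
      "\<forall>x\<in>realizations M (tp M E a'). \<exists>(\<phi>, b)\<in>D. sat M (x @ b) \<phi>"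
      using sorts by (auto simp: forks_def tp_def)
    define N where "N = (\<lambda>(\<phi>, b). (Neg \<phi>, b)) ` D"
    let ?A = "E \<union> (\<Union>(\<phi>, b)\<in>D. set b)"
    have "\<not> partial_type M ?A (?ss, snd (tp M E a') \<union> N)"
    proof
      assume "partial_type M ?A (?ss, snd (tp M E a') \<union> N)"
      moreover have "small \<kappa> ?A" using assms(1) D(1) by (auto simp: small_Un intro: small_finite)
      ultimately obtain x where x: "x \<in> realizations M (?ss, snd (tp M E a') \<union> N)"
        using realized by blast
      then have "x \<in> realizations M (tp M E a')" using sorts by (auto simp: realizations_def tp_def)
      then obtain \<phi> b where "(\<phi>, b) \<in> D" "sat M (x @ b) \<phi>" using D(3) by blast
      moreover from this have "(Neg \<phi>, b) \<in> N" by (force simp: N_def)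
      moreover from this have "sat M (x @ b) (Neg \<phi>)"
        using realizations_sat[OF x, of "Neg \<phi>" b] by simp
      ultimately show False by simp
    qed
    then obtain F where F: "F \<subseteq> snd (tp M E a') \<union> N" "finite F" "realizations M (?ss, F) = {}"
      by (force simp: partial_type_def N_def tp_def)
    let ?F = "F \<inter> snd (tp M E a')"
    obtain \<Phi> bs where bs: "set bs \<subseteq> (\<Union>(\<phi>, cs)\<in>?F. set cs)"
      "\<And>x. length x = length a \<Longrightarrow> sat M (x @ bs) \<Phi> \<longleftrightarrow> (\<forall>(\<phi>, cs)\<in>?F. sat M (x @ cs) \<phi>)"
      using conjunction_with_parameters[of ?F "length a" M] F(2) by blast
    have "set bs \<subseteq> E" using bs(1) by (fastforce simp: tp_def)
    moreover have "forks M C (?ss, {(\<Phi>, bs)})"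
      unfolding forks_def
    proof (intro exI[of _ D] conjI ballI)
      fix x assume x: "x \<in> realizations M (?ss, {(\<Phi>, bs)})"
      then have xt: "x \<in> tuples M ?ss" "length x = length a"
        by (auto simp: realizations_def dest: length_tuples)
      then have "\<forall>(\<phi>, cs)\<in>?F. sat M (x @ cs) \<phi>"
        using x bs(2) by (simp add: realizations_def)
      moreover obtain \<theta> b where "(\<theta>, b) \<in> F" "\<not> sat M (x @ b) \<theta>"
        using F(3) xt(1) by (auto simp: realizations_def)
      ultimately have "(\<theta>, b) \<in> N" using F(1) by blast
      then show "\<exists>(\<phi>, b)\<in>D. sat M (x @ b) \<phi>"
        using \<open>\<not> sat M (x @ b) \<theta>\<close> by (force simp: N_def)
    qed (use D in auto)
    ultimately have "(Neg \<Phi>, bs) \<in> \<Gamma>" by (auto simp: \<Gamma>_def)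
    then have "\<not> sat M (a' @ bs) \<Phi>" using realizations_sat[OF a', of "Neg \<Phi>" bs] by simp
    moreover have "sat M (a' @ bs) \<Phi>"
      using bs(2)[of a'] tp_eqD(2)[OF tp] by (auto simp: tp_def)
    ultimately show False by blast
  qed
  then have "independent M C a' E"
    using assms(2,3) by (simp add: independent_def Un_absorb2 subset_trans)
  with tp that show thesis by blast
qed

text \<open>
  Let \<open>\<gamma>(y; x, c)\<close> define \<open>b\<close>.  A formula \<open>\<phi>(y, e)\<close> dividing over \<open>c\<close> pulls back along \<open>\<gamma>\<close> to the formula
  \<open>\<psi>(x; c, e)\<close> saying that \<open>\<gamma>(\<cdot>; x, c)\<close> is nonempty and contained in \<open>\<phi>(\<cdot>, e)\<close>.  This divides over \<open>C\<close>:
  a sequence \<open>d i\<close> of conjugates of \<open>e\<close> over \<open>c\<close> yields conjugates of \<open>(c, e)\<close> with constant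
  first part, so a common solution \<open>x\<close> provides one \<open>y\<close> that serves all the \<open>d i\<close>.  Thus a covering that
  shows that \<open>b\<close> forks over \<open>c\<close> is pulled back to one for \<open>x\<close> over \<open>C\<close>.
\<close>

lemma independent_definable:
  assumes "small \<kappa> D" "independent M C x D" "C \<subseteq> set c" "set c \<subseteq> D"
    and "definable M (set x \<union> set c) (map (sort_of M) b) {b}"
  shows "independent M (set c) b D"
  unfolding independent_def
proof
  let ?sb = "map (sort_of M) b" and ?sx = "map (sort_of M) x"
  let ?m = "length b" and ?n = "length x + length c"
  obtain \<gamma> bs where \<gamma>: "set bs \<subseteq> set x \<union> set c" "{b} = {y \<in> tuples M ?sb. sat M (y @ bs) \<gamma>}"
    using assms(5) by (auto simp: definable_def)
  have "set bs \<subseteq> set (x @ c)" using \<gamma>(1) by simp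
  then obtain js where js: "set js \<subseteq> {..<length (x @ c)}" "bs = map ((!) (x @ c)) js"
    by (rule nth_representation)
  have unique: "y = b \<longleftrightarrow> y \<in> tuples M ?sb \<and> sat M (y @ map ((!) (x @ c)) js) \<gamma>" for y
    using \<gamma>(2) js(2) by blast
  define lifts where "lifts \<phi> l \<psi> \<longleftrightarrow> (\<forall>x' e. length x' = length x \<longrightarrow> length e = l \<longrightarrow>
      (sat M (x' @ c @ e) \<psi> \<longleftrightarrow>
        (\<exists>y\<in>tuples M ?sb. sat M (y @ map ((!) (x' @ c)) js) \<gamma>) \<and>
        (\<forall>y\<in>tuples M ?sb. sat M (y @ map ((!) (x' @ c)) js) \<gamma> \<longrightarrow> sat M (y @ e) \<phi>)))" for \<phi> l \<psi>
  have "\<exists>\<psi>. lifts \<phi> l \<psi>" for \<phi> l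
  proof -
    define G where "G e \<longleftrightarrow> sat M (take ?m e @ map ((!) (take ?n (drop ?m e))) js) \<gamma>" for e
    have G: "expressible M (?m + (?n + l)) G"
      unfolding G_def
      by (intro expressible_sat selects_append[OF selects_take selects_map[OF selects_block]])
        (use js(1) in auto)
    have "expressible M (?m + (?n + l)) (\<lambda>e. sat M (take ?m e @ drop (?m + ?n) e) \<phi>)"
      by (intro expressible_sat selects_append[OF selects_take selects_drop]) auto
    with G have "expressible M (length ?sb + (?n + l))
        (\<lambda>e. G e \<and> \<not> sat M (take ?m e @ drop (?m + ?n) e) \<phi>)"
      by (simp only: length_map) (intro expressible_conj expressible_not)
    moreover have "expressible M (length ?sb + (?n + l)) G" using G by simp
    ultimately have "expressible M (?n + l) (\<lambda>e. (\<exists>y\<in>tuples M ?sb. G (y @ e)) \<and>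
        \<not> (\<exists>y\<in>tuples M ?sb. G (y @ e) \<and> \<not> sat M (take ?m (y @ e) @ drop (?m + ?n) (y @ e)) \<phi>))"
      by (intro expressible_conj[OF expressible_ex expressible_not[OF expressible_ex]])
    then obtain \<psi> where \<psi>: "\<And>e. length e = ?n + l \<Longrightarrow> sat M e \<psi> \<longleftrightarrow> (\<exists>y\<in>tuples M ?sb. G (y @ e)) \<and>
        \<not> (\<exists>y\<in>tuples M ?sb. G (y @ e) \<and> \<not> sat M (take ?m (y @ e) @ drop (?m + ?n) (y @ e)) \<phi>)"
      unfolding expressible_def by blast
    have len: "length y = ?m" if "y \<in> tuples M ?sb" for y
      using length_tuples[OF that] by simp
    show ?thesis
      unfolding lifts_def
    proof (intro exI[of _ \<psi>] allI impI)
      fix x' e :: "'m list" assume "length x' = length x" "length e = l"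
      then show "sat M (x' @ c @ e) \<psi> \<longleftrightarrow>
        (\<exists>y\<in>tuples M ?sb. sat M (y @ map ((!) (x' @ c)) js) \<gamma>) \<and>
        (\<forall>y\<in>tuples M ?sb. sat M (y @ map ((!) (x' @ c)) js) \<gamma> \<longrightarrow> sat M (y @ e) \<phi>)"
        using \<psi>[of "x' @ c @ e"] by (simp add: G_def len cong: bex_cong)
    qed
  qed
  then obtain \<Psi> where \<Psi>: "\<And>\<phi> l. lifts \<phi> l (\<Psi> \<phi> l)" by metis
  note \<Psi> = \<Psi>[unfolded lifts_def, rule_format]
  have divides: "divides M C ?sx (\<Psi> \<phi> (length e)) (c @ e)" if "divides M (set c) ?sb \<phi> e" for \<phi> e
    using that
  proof (rule dividesE)
    fix d :: "nat \<Rightarrow> 'm list" and k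
    assume d: "\<And>i. tp M (set c) (d i) = tp M (set c) e"
      "\<And>I y. finite I \<Longrightarrow> card I = k \<Longrightarrow> y \<in> tuples M ?sb \<Longrightarrow> \<exists>i\<in>I. \<not> sat M (y @ d i) \<phi>"
    show ?thesis
    proof (rule dividesI)
      fix i
      obtain \<sigma> where \<sigma>: "automorphism M \<sigma>" "\<forall>z\<in>set c. \<sigma> z = z" "map \<sigma> (d i) = e"
        using conjugate[OF small_finite d(1)] by blast
      then have "map \<sigma> (c @ d i) = c @ e" by (simp add: map_idI)
      then show "tp M C (c @ d i) = tp M C (c @ e)"
        using tp_fixing_automorphism[OF \<sigma>(1), of C "c @ d i"] \<sigma>(2) assms(3)
        by (metis subsetD)
    next
      fix I :: "nat set" and x' assume I: "finite I" "card I = k" and x': "x' \<in> tuples M ?sx"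
      have len: "length x' = length x" using length_tuples[OF x'] by simp
      have len': "length (d i) = length e" for i using tp_eqD(2)[OF d(1)] .
      show "\<exists>i\<in>I. \<not> sat M (x' @ c @ d i) (\<Psi> \<phi> (length e))"
      proof (cases "\<exists>y\<in>tuples M ?sb. sat M (y @ map ((!) (x' @ c)) js) \<gamma>")
        case True
        then obtain y where y: "y \<in> tuples M ?sb" "sat M (y @ map ((!) (x' @ c)) js) \<gamma>" by blast
        then obtain i where "i \<in> I" "\<not> sat M (y @ d i) \<phi>" using d(2)[OF I] by blast
        with y show ?thesis unfolding \<Psi>[OF len len'] by blast
      next
        case False
        have "I \<noteq> {}" using d(2)[OF I, of b] by (auto simp: tuples_def)
        with False show ?thesis unfolding \<Psi>[OF len len'] by blast
      qed
    qed
  qed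
  assume "forks M (set c) (tp M (D \<union> set c) b)"
  then obtain \<Delta> where \<Delta>: "finite \<Delta>" "\<forall>(\<phi>, e)\<in>\<Delta>. divides M (set c) ?sb \<phi> e"
    "\<And>y. y \<in> realizations M (tp M D b) \<Longrightarrow> \<exists>(\<phi>, e)\<in>\<Delta>. sat M (y @ e) \<phi>"
    using assms(4) by (auto simp: forks_def tp_def Un_absorb2)
  define \<Delta>' where "\<Delta>' = (\<lambda>(\<phi>, e). (\<Psi> \<phi> (length e), c @ e)) ` \<Delta>"
  have "\<exists>(\<phi>, e)\<in>\<Delta>'. sat M (x' @ e) \<phi>" if "x' \<in> realizations M (tp M D x)" for x'
  proof -
    have tp: "tp M D x' = tp M D x" using that realizations_tp by blast
    then obtain \<sigma> where \<sigma>: "automorphism M \<sigma>" "\<forall>z\<in>D. \<sigma> z = z" "map \<sigma> x = x'"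
      using conjugate[OF assms(1)] by metis
    let ?b = "map \<sigma> b"
    have c: "map \<sigma> c = c" by (rule map_fixed[OF assms(4) \<sigma>(2)])
    have parameters: "map \<sigma> (map ((!) (x @ c)) js) = map ((!) (x' @ c)) js"
    proof -
      have "map \<sigma> (map ((!) (x @ c)) js) = map ((!) (map \<sigma> (x @ c))) js"
        using js(1) by (auto simp: subset_iff simp del: map_append)
      then show ?thesis by (simp only: map_append \<sigma>(3) c)
    qed
    have b: "y = ?b \<longleftrightarrow> y \<in> tuples M ?sb \<and> sat M (y @ map ((!) (x' @ c)) js) \<gamma>" for y
    proof -
      let ?y = "map (inv \<sigma>) y"
      have y: "map \<sigma> ?y = y" by (rule map_inv_automorphism[OF \<sigma>(1)])
      have "y = ?b \<longleftrightarrow> ?y = b"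
        using y map_inv_automorphism(1)[OF \<sigma>(1), of b] by auto
      also have "\<dots> \<longleftrightarrow> ?y \<in> tuples M ?sb \<and> sat M (?y @ map ((!) (x @ c)) js) \<gamma>"
        by (rule unique)
      also have "?y \<in> tuples M ?sb \<longleftrightarrow> y \<in> tuples M ?sb"
        using tuples_automorphism[OF \<sigma>(1), of ?y] unfolding y by blast
      also have "sat M (?y @ map ((!) (x @ c)) js) \<gamma> \<longleftrightarrow> sat M (y @ map ((!) (x' @ c)) js) \<gamma>"
        using sat_automorphism[OF \<sigma>(1), of "?y @ map ((!) (x @ c)) js" \<gamma>]
        unfolding map_append y parameters by blast
      finally show ?thesis .
    qed
    have "tp M D ?b = tp M D b" by (rule tp_fixing_automorphism[OF \<sigma>(1,2)])
    then obtain \<phi> e where e: "(\<phi>, e) \<in> \<Delta>" "sat M (?b @ e) \<phi>"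
      using \<Delta>(3) realizations_tp by blast
    have len: "length x' = length x" using \<sigma>(3) by auto
    have "sat M (x' @ c @ e) (\<Psi> \<phi> (length e))"
      unfolding \<Psi>[OF len refl] by (metis b e(2))
    then show ?thesis using e(1) by (force simp: \<Delta>'_def)
  qed
  moreover have "finite \<Delta>'" using \<Delta>(1) by (simp add: \<Delta>'_def)
  moreover have "\<forall>(\<phi>, e)\<in>\<Delta>'. divides M C (fst (tp M D x)) \<phi> e"
    unfolding \<Delta>'_def tp_def fst_conv using \<Delta>(2) by (auto intro!: divides)
  ultimately have "forks M C (tp M D x)" unfolding forks_def by blast
  moreover have "D \<union> C = D" using assms(3,4) by blast
  ultimately show False using assms(2) by (simp add: independent_def)
qed

end

section \<open>Transitivity and stationarity\<close>

context monster_model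
begin

text \<open>
  The core of left transitivity.  Let \<open>(d i)\<close> witness that \<open>\<phi>(x y, b)\<close> divides over \<open>\<emptyset>\<close>.  To see
  that \<open>\<phi>(u y, b)\<close>, in the form \<open>\<psi>(y, u b)\<close> with \<open>u\<close> among the parameters, divides over \<open>u\<close>, it suffices by compactness to find arbitrarily long finite
  \<open>k\<close>-inconsistent sequences of realizations of a given formula \<open>\<chi>(u, z)\<close> true of \<open>b\<close>.  Let \<open>\<theta>(x, z)\<close> say that \<open>\<chi>(x, z)\<close>
  holds and that no such sequence of length \<open>N\<close> exists for \<open>x\<close> in place of \<open>u\<close>.  If \<open>\<theta>(u, b)\<close> held,
  then \<open>\<theta>(x, b)\<close> would not divide, so some \<open>x\<close> would satisfy \<open>\<theta>(x, d i)\<close> for \<open>N + 1\<close> indices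
  \<open>i\<close>; but these \<open>d i\<close> are themselves a sequence of the kind that \<open>\<theta>\<close> excludes for \<open>x\<close>.
\<close>

lemma divides_fibre:
  assumes "divides M {} (map (sort_of M) u @ sa) \<phi> b"
    and nondividing: "\<And>\<psi>. sat M (u @ b) \<psi> \<Longrightarrow> \<not> divides M {} (map (sort_of M) u) \<psi> b"
  shows "\<exists>\<psi>. (\<forall>x y z. length x = length u \<longrightarrow> length y = length sa \<longrightarrow> length z = length b \<longrightarrow>
      (sat M (y @ x @ z) \<psi> \<longleftrightarrow> sat M (x @ y @ z) \<phi>)) \<and> divides M (set u) sa \<psi> (u @ b)"
proof -
  let ?su = "map (sort_of M) u" and ?ts = "map (sort_of M) (u @ b)"
  let ?la = "length sa" and ?lu = "length u" and ?lb = "length b"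
  have "expressible M (?la + (?lu + ?lb))
      (\<lambda>e. sat M (take ?lu (drop ?la e) @ take ?la e @ drop (?la + ?lu) e) \<phi>)"
    by (intro expressible_sat[OF selects_append[OF selects_block selects_append[OF selects_take selects_drop]]]) auto
  then obtain \<psi> where "\<And>e. length e = ?la + (?lu + ?lb) \<Longrightarrow>
      sat M e \<psi> \<longleftrightarrow> sat M (take ?lu (drop ?la e) @ take ?la e @ drop (?la + ?lu) e) \<phi>"
    by (auto simp: expressible_def)
  then have \<psi>: "sat M (y @ x @ z) \<psi> \<longleftrightarrow> sat M (x @ y @ z) \<phi>"
    if "length x = ?lu" "length y = ?la" "length z = ?lb" for x y z
    using that by simp
  from assms(1) have "divides M (set u) sa \<psi> (u @ b)"
  proof (rule dividesE)
    fix d :: "nat \<Rightarrow> 'm list" and k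
    assume d: "\<And>i. tp M {} (d i) = tp M {} b"
      "\<And>I x. finite I \<Longrightarrow> card I = k \<Longrightarrow> x \<in> tuples M (?su @ sa) \<Longrightarrow> \<exists>i\<in>I. \<not> sat M (x @ d i) \<phi>"
    have dt: "d i \<in> tuples M (map (sort_of M) b)" "length (d i) = ?lb" for i
      using tp_eqD[OF d(1)[of i]] by (auto simp: tuples_def)
    show ?thesis
    proof (rule divides_by_compactness)
      show "small \<kappa> (set u)" by (simp add: small_finite)
    next
      fix \<chi> cs N assume cs: "set cs \<subseteq> set u" and \<chi>: "sat M ((u @ b) @ cs) \<chi>"
      obtain js where js: "set js \<subseteq> {..<?lu}" "cs = map ((!) u) js"
        using cs by (rule nth_representation)
      \<comment> \<open>The parameters of \<open>\<chi>\<close> are entries of \<open>u\<close>; for \<open>x\<close> in place of \<open>u\<close> they become the entries of \<open>x\<close> at the same places.\<close>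
      define par where "par x = map ((!) x) js" for x :: "'m list"
      have par: "selects (?lu + ?lb) (length js) (\<lambda>e. par (take ?lu e))"
        unfolding par_def using js(1) by (intro selects_map[OF selects_take]) auto
      have "selects (?lu + ?lb) (?lu + ?lb) (\<lambda>e :: 'm list. e)"
        using selects_drop[of "?lu + ?lb" 0] by simp
      then have "expressible M (?lu + ?lb) (\<lambda>e. sat M (e @ par (take ?lu e)) \<chi>)"
        by (rule expressible_sat[OF selects_append[OF _ par refl]])
      moreover have "expressible M (length js) (\<lambda>e. extendable M sa \<psi> k ?ts \<chi> e N [])"
        using expressible_extendable[of M 0 ?ts "length js" sa \<psi> k \<chi> N] by (simp add: blocks_def)
      ultimately have "expressible M (?lu + ?lb) (\<lambda>e. sat M (e @ par (take ?lu e)) \<chi> \<and>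
          \<not> extendable M sa \<psi> k ?ts \<chi> (par (take ?lu e)) N [])"
        by (rule expressible_conj[OF _ expressible_not[OF expressible_selects[OF _ par]]])
      then obtain \<theta> where "\<And>e. length e = ?lu + ?lb \<Longrightarrow> sat M e \<theta> \<longleftrightarrow>
          sat M (e @ par (take ?lu e)) \<chi> \<and> \<not> extendable M sa \<psi> k ?ts \<chi> (par (take ?lu e)) N []"
        by (auto simp: expressible_def)
      then have \<theta>: "sat M (x @ z) \<theta> \<longleftrightarrow>
          sat M (x @ z @ par x) \<chi> \<and> \<not> extendable M sa \<psi> k ?ts \<chi> (par x) N []"
        if "length x = ?lu" "length z = ?lb" for x z
        using that by simp
      show "extendable M sa \<psi> k ?ts \<chi> cs N []"
      proof (rule ccontr)
        assume "\<not> extendable M sa \<psi> k ?ts \<chi> cs N []"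
        then have "sat M (u @ b) \<theta>" using \<theta>[of u b] \<chi> js(2) by (simp add: par_def)
        then have "\<not> divides M {} ?su \<theta> b" by (rule nondividing)
        then obtain I x where I: "finite I" "card I = Suc N" and x: "x \<in> tuples M ?su"
          and sat: "\<And>i. i \<in> I \<Longrightarrow> sat M (x @ d i) \<theta>"
          using dividesI[of M "{}" d b "Suc N" ?su \<theta>, OF d(1)] by blast
        have lx: "length x = ?lu" using length_tuples[OF x] by simp
        define ks where "ks = sorted_list_of_set I"
        have ks: "set ks = I" "distinct ks" "length ks = Suc N"
          using I by (simp_all add: ks_def)
        define es where "es = map (\<lambda>i. x @ d i) ks"
        have "\<forall>e\<in>set es. e \<in> tuples M ?ts \<and> sat M (e @ par x) \<chi>"
          using sat ks(1) \<theta>[OF lx dt(2)] x dt(1) by (auto simp: es_def tuples_def)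
        moreover have "k_inconsistent M sa \<psi> k es"
          unfolding k_inconsistent_def
        proof (intro allI impI notI)
          fix J assume J: "J \<subseteq> {..<length es}" "card J = k"
          assume "\<exists>y\<in>tuples M sa. \<forall>j\<in>J. sat M (y @ es ! j) \<psi>"
          then obtain y where y: "y \<in> tuples M sa" "\<And>j. j \<in> J \<Longrightarrow> sat M (y @ es ! j) \<psi>"
            by blast
          have J': "J \<subseteq> {..<length ks}" using J(1) by (simp add: es_def)
          have "inj_on ((!) ks) J" using J' ks(2) by (auto intro!: inj_on_nth)
          then have "card ((!) ks ` J) = k" using J(2) by (simp add: card_image)
          moreover have "finite ((!) ks ` J)" using J' finite_subset by blast
          moreover have "x @ y \<in> tuples M (?su @ sa)" using x y(1) by (auto simp: tuples_def)
          ultimately obtain i where i: "i \<in> (!) ks ` J" "\<not> sat M ((x @ y) @ d i) \<phi>"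
            using d(2) by blast
          then obtain j where j: "j \<in> J" "i = ks ! j" by blast
          then have "es ! j = x @ d i" using J' by (auto simp: es_def)
          then have "sat M (y @ x @ d i) \<psi>" using y(2)[OF j(1)] by simp
          then show False using \<psi>[OF lx length_tuples[OF y(1)] dt(2)] i(2) by simp
        qed
        ultimately have "extendable M sa \<psi> k ?ts \<chi> (par x) (Suc N) []"
          using extendable_intro[of es M ?ts "par x" \<chi> sa \<psi> k "[]"] ks(3) by (simp add: es_def)
        then have "extendable M sa \<psi> k ?ts \<chi> (par x) N []" by (rule extendable_Suc)
        \<comment> \<open>\<open>I\<close> has \<open>N + 1\<close> elements rather than \<open>N\<close>, so that it is nonempty also for \<open>N = 0\<close>.\<close>
        moreover obtain i where "i \<in> I" using I by fastforce
        ultimately show False using sat \<theta>[OF lx dt(2)] by blast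
      qed
    qed
  qed
  with \<psi> show ?thesis by blast
qed

text \<open>
  If the type of \<open>ua\<close> over \<open>D\<close> is covered by finitely many formulas dividing over \<open>\<emptyset>\<close>, move
  \<open>ua\<close> over \<open>D\<close> so that both independences hold also with the parameters of these formulas added
  to \<open>D\<close>.  One of the formulas is true of the new pair \<open>(u', a')\<close>.  By \<open>divides_fibre\<close> it divides
  over \<open>u'\<close> as a formula about \<open>a'\<close>, against the independence of \<open>a'\<close> over \<open>u'\<close>.
\<close>

lemma independent_append:
  assumes "small \<kappa> D" "independent M {} u D" "independent M (set u) a D"
  shows "independent M {} (u @ a) D"
  unfolding independent_def
proof
  let ?su = "map (sort_of M) u" and ?sa = "map (sort_of M) a"
  assume "forks M {} (tp M (D \<union> {}) (u @ a))"
  then obtain \<Delta> where \<Delta>: "finite \<Delta>" "\<And>\<phi> b. (\<phi>, b) \<in> \<Delta> \<Longrightarrow> divides M {} (?su @ ?sa) \<phi> b"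
    "\<And>x. x \<in> realizations M (tp M D (u @ a)) \<Longrightarrow> \<exists>(\<phi>, b)\<in>\<Delta>. sat M (x @ b) \<phi>"
    by (auto simp: forks_def tp_def)
  let ?E = "D \<union> (\<Union>(\<phi>, b)\<in>\<Delta>. set b)"
  have E: "small \<kappa> ?E" using assms(1) \<Delta>(1) by (auto simp: small_Un intro: small_finite)
  obtain u' where u': "tp M D u' = tp M D u" "independent M {} u' ?E"
    using nonforking_extension[OF E _ _ assms(2)] by blast
  obtain \<sigma> where \<sigma>: "automorphism M \<sigma>" "\<forall>x\<in>D. \<sigma> x = x" "map \<sigma> u = u'"
    using conjugate[OF assms(1) u'(1)[symmetric]] by blast
  have "\<sigma> ` set u = set u'" "\<sigma> ` D = D" using \<sigma>(2,3) by auto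
  then have "independent M (set u') (map \<sigma> a) D"
    using independent_automorphism[OF \<sigma>(1) assms(3)] by simp
  then have "independent M (set u') (map \<sigma> a) (D \<union> set u')"
    by (rule independent_subset) simp
  moreover have "small \<kappa> (?E \<union> set u')" using E by (simp add: small_Un small_finite)
  ultimately obtain a' where a': "tp M (D \<union> set u') a' = tp M (D \<union> set u') (map \<sigma> a)"
    "independent M (set u') a' (?E \<union> set u')"
    using nonforking_extension[of "?E \<union> set u'" "set u'" "D \<union> set u'" "map \<sigma> a"] by blast
  have "tp M D (u' @ a') = tp M D (u' @ map \<sigma> a)"
  proof (rule tp_eqI)
    show "map (sort_of M) (u' @ a') = map (sort_of M) (u' @ map \<sigma> a)"
      using tp_eqD(1)[OF a'(1)] by simp
  next
    have "small \<kappa> (D \<union> set u')" using assms(1) by (simp add: small_Un small_finite)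
    then obtain \<tau> where \<tau>: "automorphism M \<tau>" "\<forall>x\<in>D \<union> set u'. \<tau> x = x" "map \<tau> a' = map \<sigma> a"
      using conjugate a'(1) by blast
    fix \<phi> bs assume bs: "set bs \<subseteq> D" and "sat M ((u' @ a') @ bs) \<phi>"
    then have "sat M (map \<tau> ((u' @ a') @ bs)) \<phi>" using sat_automorphism[OF \<tau>(1)] by blast
    moreover have "map \<tau> u' = u'" "map \<tau> bs = bs"
      using map_fixed[OF _ \<tau>(2)] bs by auto
    ultimately show "sat M ((u' @ map \<sigma> a) @ bs) \<phi>" using \<tau>(3) by simp
  qed
  also have "u' @ map \<sigma> a = map \<sigma> (u @ a)" using \<sigma>(3) by simp
  also have "tp M D (map \<sigma> (u @ a)) = tp M D (u @ a)"
    by (rule tp_fixing_automorphism[OF \<sigma>(1,2)])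
  finally have "u' @ a' \<in> realizations M (tp M D (u @ a))" by (simp only: realizations_tp)
  then obtain \<phi> b where \<phi>: "(\<phi>, b) \<in> \<Delta>" "sat M ((u' @ a') @ b) \<phi>" using \<Delta>(3) by blast
  have sorts: "map (sort_of M) u' = ?su" "map (sort_of M) a' = ?sa"
    using tp_eqD(1)[OF u'(1)] tp_eqD(1)[OF a'(1)] sorts_automorphism[OF \<sigma>(1), of a] by simp_all
  have b: "set b \<subseteq> ?E" using \<phi>(1) by auto
  have "\<not> divides M {} (map (sort_of M) u') \<psi> b" if "sat M (u' @ b) \<psi>" for \<psi>
    by (rule independent_not_divides[OF u'(2)]) (use b that in auto)
  moreover have "divides M {} (map (sort_of M) u' @ ?sa) \<phi> b"
    using \<Delta>(2)[OF \<phi>(1)] sorts by simp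
  ultimately obtain \<psi> where \<psi>: "divides M (set u') ?sa \<psi> (u' @ b)"
    "\<forall>x y z. length x = length u' \<longrightarrow> length y = length ?sa \<longrightarrow> length z = length b \<longrightarrow>
      (sat M (y @ x @ z) \<psi> \<longleftrightarrow> sat M (x @ y @ z) \<phi>)"
    using divides_fibre[of u' ?sa \<phi> b] by blast
  have "length a' = length ?sa" using sorts(2) by (metis length_map)
  then have "sat M (a' @ u' @ b) \<psi>" using \<psi>(2) \<phi>(2) by simp
  then have "\<not> divides M (set u') (map (sort_of M) a') \<psi> (u' @ b)"
    by (rule independent_not_divides[OF a'(2), rotated]) (use b in auto)
  with \<psi>(1) sorts(2) show False by simp
qed

lemma stationary_unique:
  assumes "stationary \<kappa> M C s" "small \<kappa> B" "C \<subseteq> B"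
    and "a \<in> realizations M s" "independent M C a B"
    and "b \<in> realizations M s" "independent M C b B"
  shows "tp M B a = tp M B b"
proof -
  have complete: "complete_type M C s" using assms(1) by (simp add: stationary_def)
  have extends: "complete_type M B (tp M B x) \<and> fst (tp M B x) = fst s \<and> snd s \<subseteq> snd (tp M B x) \<and>
      \<not> forks M C (tp M B x)" if "x \<in> realizations M s" "independent M C x B" for x
  proof (intro conjI)
    have "tp M C x = s" by (rule tp_realization[OF complete that(1)])
    then show "fst (tp M B x) = fst s" "snd s \<subseteq> snd (tp M B x)"
      using assms(3) by (auto simp: tp_def subset_iff)
    show "\<not> forks M C (tp M B x)"
      using that(2) assms(3) by (simp add: independent_def Un_absorb2)
  qed (rule complete_type_tp)
  have "\<exists>!p. complete_type M B p \<and> fst p = fst s \<and> snd s \<subseteq> snd p \<and> \<not> forks M C p"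
    using assms(1-3) unfolding stationary_def by blast
  with extends[OF assms(4,5)] extends[OF assms(6,7)] show ?thesis by blast
qed

lemma stationary_extension:
  assumes "stationary \<kappa> M C s" "small \<kappa> B" "C \<subseteq> B"
  obtains a where "a \<in> realizations M s" "independent M C a B"
proof -
  obtain p where p: "complete_type M B p" "fst p = fst s" "snd s \<subseteq> snd p" "\<not> forks M C p"
    using assms unfolding stationary_def by blast
  then obtain a where a: "a \<in> realizations M p"
    using realized[of B p] assms(2) by (auto simp: complete_type_def)
  then have "a \<in> realizations M s" using p(2,3) by (auto simp: realizations_def)
  moreover have "independent M C a B"
    using p(4) tp_realization[OF p(1) a] assms(3) by (simp add: independent_def Un_absorb2)
  ultimately show thesis by (rule that)
qed

end

section \<open>Fibres of a definable map and transport along a retraction\<close>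

lemma map_fixed_iff: "map \<sigma> a = a \<longleftrightarrow> (\<forall>x\<in>set a. \<sigma> x = x)"
  by (induction a) auto

lemma realizes_family_automorphism:
  assumes "\<forall>\<Phi>\<in>P. partial_type M {} \<Phi>" "automorphism M \<sigma>" "c \<in> realizes_family M P"
  shows "map \<sigma> c \<in> realizes_family M P"
  using assms realizations_automorphism[OF _ assms(2)] by (auto simp: realizes_family_def)

locale fibred_type = monster_model \<kappa> M
  for \<kappa> :: "'k rel" and M :: "('f, 'r, 's, 'm) model" +
  fixes q :: "('f, 'r, 's, 'm) ptype" and \<pi> :: "'m list \<rightharpoonup> 'm list" and ts :: "'s list"
  assumes complete: "complete_type M {} q"
    and definable: "definable_fun M {} (fst q) ts \<pi>"
    and total: "realizations M q \<subseteq> dom \<pi>"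
begin

lemma realizations_q_automorphism:
  "automorphism M \<sigma> \<Longrightarrow> map \<sigma> a \<in> realizations M q \<longleftrightarrow> a \<in> realizations M q"
  by (rule realizations_automorphism) (use complete in \<open>simp add: complete_type_def\<close>)

lemma conjugate_realizations:
  assumes "a \<in> realizations M q" "b \<in> realizations M q"
  obtains \<sigma> where "automorphism M \<sigma>" "map \<sigma> a = b"
proof -
  have "tp M {} a = tp M {} b"
    using assms tp_realization[OF complete] by simp
  then show thesis
    by (rule conjugate[OF small_finite[OF finite.emptyI]]) (rule that)
qed

lemma image_type_eq:
  assumes "a \<in> realizations M q" "\<pi> a = Some u"
  shows "image_type M \<pi> q = tp M {} u"
  unfolding image_type_def
proof (rule the_equality)
  show "\<forall>b\<in>realizations M q. tp M {} u = tp M {} (the (\<pi> b))"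
  proof
    fix b assume "b \<in> realizations M q"
    then obtain \<sigma> where \<sigma>: "automorphism M \<sigma>" "map \<sigma> a = b"
      using conjugate_realizations[OF assms(1)] by blast
    have "\<pi> b = Some (map \<sigma> u)"
      using definable_fun_automorphism[OF definable \<sigma>(1) assms(2)] \<sigma>(2) by simp
    then show "tp M {} u = tp M {} (the (\<pi> b))"
      using tp_fixing_automorphism[OF \<sigma>(1), of "{}" u] by simp
  qed
next
  fix p assume "\<forall>b\<in>realizations M q. p = tp M {} (the (\<pi> b))"
  then show "p = tp M {} u" using assms by force
qed

lemma image_type_tp:
  obtains u where "image_type M \<pi> q = tp M {} u"
proof -
  obtain a where "a \<in> realizations M q"
    using realized[of "{}" q] complete small_finite[of "{}"] by (auto simp: complete_type_def)
  moreover from this obtain u where "\<pi> a = Some u" using total by blast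
  ultimately show thesis using image_type_eq that by blast
qed

lemma image_type_automorphism:
  assumes "automorphism M \<sigma>" "u \<in> realizations M (image_type M \<pi> q)"
  shows "map \<sigma> u \<in> realizations M (image_type M \<pi> q)"
proof -
  obtain v where v: "image_type M \<pi> q = tp M {} v" by (rule image_type_tp)
  have "tp M {} (map \<sigma> u) = tp M {} u" by (rule tp_fixing_automorphism[OF assms(1)]) simp
  then show ?thesis using assms(2) by (simp add: v realizations_tp)
qed

lemma image_type_lift:
  assumes "u \<in> realizations M (image_type M \<pi> q)"
  obtains a where "a \<in> realizations M q" "\<pi> a = Some u"
proof -
  obtain a where a: "a \<in> realizations M q"
    using realized[of "{}" q] complete small_finite[of "{}"] by (auto simp: complete_type_def)
  then obtain v where v: "\<pi> a = Some v" using total by blast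
  have "tp M {} v = tp M {} u"
    using assms image_type_eq[OF a v] realizations_tp by metis
  then obtain \<sigma> where \<sigma>: "automorphism M \<sigma>" "map \<sigma> v = u"
    by (rule conjugate[OF small_finite[OF finite.emptyI]])
  show thesis
  proof (rule that)
    show "map \<sigma> a \<in> realizations M q" using realizations_q_automorphism[OF \<sigma>(1)] a by blast
    show "\<pi> (map \<sigma> a) = Some u"
      using definable_fun_automorphism[OF definable \<sigma>(1) v] \<sigma>(2) by simp
  qed
qed

lemma realizations_fibre:
  assumes "a \<in> realizations M q" "\<pi> a = Some u"
  shows "x \<in> realizations M (tp M (set u) a) \<longleftrightarrow> x \<in> realizations M q \<and> \<pi> x = Some u"
proof
  assume "x \<in> realizations M (tp M (set u) a)"
  then have "tp M (set u) a = tp M (set u) x" by (simp add: realizations_tp)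
  then obtain \<sigma> where \<sigma>: "automorphism M \<sigma>" "\<forall>z\<in>set u. \<sigma> z = z" "map \<sigma> a = x"
    using conjugate small_finite[of "set u"] by blast
  have "map \<sigma> u = u" using \<sigma>(2) by (simp add: map_fixed_iff)
  then show "x \<in> realizations M q \<and> \<pi> x = Some u"
    using definable_fun_automorphism[OF definable \<sigma>(1) assms(2)] \<sigma>(3)
      realizations_q_automorphism[OF \<sigma>(1), of a] assms(1) by simp
next
  assume x: "x \<in> realizations M q \<and> \<pi> x = Some u"
  then obtain \<sigma> where \<sigma>: "automorphism M \<sigma>" "map \<sigma> a = x"
    using conjugate_realizations[OF assms(1)] by blast
  then have "map \<sigma> u = u"
    using definable_fun_automorphism[OF definable \<sigma>(1) assms(2)] x by simp
  then have "tp M (set u) x = tp M (set u) a"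
    using tp_fixing_automorphism[OF \<sigma>(1), of "set u" a] \<sigma>(2) by (simp add: map_fixed_iff)
  then show "x \<in> realizations M (tp M (set u) a)" by (simp add: realizations_tp)
qed

lemma fibre_type_eq:
  assumes "a \<in> realizations M q" "\<pi> a = Some u"
  shows "fibre_type M \<pi> q u = tp M (set u) a"
  unfolding fibre_type_def
proof (rule the_equality)
  show "\<exists>b\<in>realizations M q. \<pi> b = Some u \<and> tp M (set u) a = tp M (set u) b"
    using assms by blast
next
  fix p assume "\<exists>b\<in>realizations M q. \<pi> b = Some u \<and> p = tp M (set u) b"
  then show "p = tp M (set u) a"
    using realizations_fibre[OF assms] realizations_tp by metis
qed

text \<open>
  By homogeneity the realizations of the fibre type over \<open>u\<close> are exactly the \<open>x \<Turnstile> q\<close> with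
  \<open>\<pi>(x) = u\<close>, which gives the domain of the partial map recorded by a morphism.
\<close>

lemma binding_groupoid_morphism:
  assumes "m \<in> Mor (binding_groupoid M P \<pi> q)"
  obtains u v \<sigma> where "automorphism M \<sigma>" "map \<sigma> u = v" "u \<in> realizations M (image_type M \<pi> q)"
    "Dom (binding_groupoid M P \<pi> q) m = u" "Cod (binding_groupoid M P \<pi> q) m = v"
    "\<And>x. fst (snd m) x =
      (if x \<in> realizations M q \<and> \<pi> x = Some u then Some (map \<sigma> x) else None)"
proof -
  obtain u v f where m: "m = (u, f, v)" by (metis surj_pair)
  then obtain \<sigma> where \<sigma>: "automorphism M \<sigma>" "map \<sigma> u = v"
    "u \<in> realizations M (image_type M \<pi> q)"
    "f = (\<lambda>x. Some (map \<sigma> x)) |` realizations M (fibre_type M \<pi> q u)"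
    using assms by (auto simp: binding_groupoid_def aut_over_def)
  obtain a where a: "a \<in> realizations M q" "\<pi> a = Some u"
    using \<sigma>(3) by (rule image_type_lift)
  have "f x = (if x \<in> realizations M q \<and> \<pi> x = Some u then Some (map \<sigma> x) else None)" for x
    unfolding \<sigma>(4) fibre_type_eq[OF a] using realizations_fibre[OF a, of x]
    by (simp add: restrict_map_def)
  then show thesis using that[OF \<sigma>(1-3)] m by (simp add: binding_groupoid_def)
qed

text \<open>
  Take \<open>b = h(a)\<close> for the morphism \<open>h = g(u, v)\<close>.  An automorphism \<open>\<tau>\<close> fixing \<open>u\<close> and \<open>v\<close> fixes \<open>h\<close>,
  as \<open>g\<close> is definable over \<open>\<emptyset>\<close>, and it respects the action; hence \<open>h(\<tau>(a)) = \<tau>(b)\<close>.  Since \<open>h\<close> is a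
  bijection, \<open>\<tau>\<close> fixes \<open>a\<close> if and only if it fixes \<open>b\<close>.  In other words, \<open>a\<close> and \<open>b\<close> are
  interdefinable over \<open>u\<close> and \<open>v\<close>.
\<close>

lemma retraction_transport:
  assumes H: "type_definable_binding_groupoid M P \<pi> q os ms H" "retractable M os ms H"
    and u: "u \<in> realizations M (image_type M \<pi> q)" and v: "v \<in> realizations M (image_type M \<pi> q)"
    and a: "a \<in> realizations M q" "\<pi> a = Some u"
  obtains b where "b \<in> realizations M q" "\<pi> b = Some v"
    "\<And>\<tau>. automorphism M \<tau> \<Longrightarrow> map \<tau> u = u \<Longrightarrow> map \<tau> v = v \<Longrightarrow> map \<tau> a = a \<longleftrightarrow> map \<tau> b = b"
proof -
  let ?G = "binding_groupoid M P \<pi> q"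
  obtain F where F: "groupoid_iso F H ?G"
    and action: "relatively_definable M {} (ms @ fst q @ fst q)
          {h @ a @ b | h a b. h \<in> Mor H \<and> a \<in> realizations M q \<and> b \<in> realizations M q}
          {h @ a @ b | h a b. h \<in> Mor H \<and> (fst (snd (F h))) a = Some b}"
    using H(1) unfolding type_definable_binding_groupoid_def by blast
  obtain D where D: "definable M {} (ms @ fst q @ fst q) D"
    and eq: "{h @ a @ b | h a b. h \<in> Mor H \<and> (fst (snd (F h))) a = Some b} =
      {h @ a @ b | h a b. h \<in> Mor H \<and> a \<in> realizations M q \<and> b \<in> realizations M q} \<inter> D"
    using action unfolding relatively_definable_def by (elim exE conjE)
  have Obj: "Obj H = realizations M (image_type M \<pi> q)"
    using F by (simp add: groupoid_iso_def binding_groupoid_def)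
  have Mor: "F h \<in> Mor ?G" if "h \<in> Mor H" for h
    using F that by (auto simp: groupoid_iso_def bij_betw_def)
  have "type_definable M {} ms (Mor H)"
    using H(1) by (simp add: type_definable_binding_groupoid_def type_definable_groupoid_def)
  then have length_Mor: "length h = length ms" if "h \<in> Mor H" for h
    using that by (auto simp: type_definable_def realizations_def dest: length_tuples)
  have length_q: "length x = length (fst q)" if "x \<in> realizations M q" for x
    using that by (auto simp: realizations_def dest: length_tuples)
  obtain g where g: "definable_fun M {} (os @ os) ms g"
    "\<forall>u\<in>Obj H. \<forall>v\<in>Obj H. \<exists>h\<in>hom_set H u v. g (u @ v) = Some h"
    using H(2) unfolding retractable_def by blast
  obtain h where h: "h \<in> hom_set H u v" "g (u @ v) = Some h" using g(2) u v Obj by blast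
  then have hM: "h \<in> Mor H" by (simp add: hom_set_def)
  have Dom: "Dom ?G (F h) = u" "Cod ?G (F h) = v"
    using F h(1) hM by (auto simp: groupoid_iso_def hom_set_def)
  obtain \<sigma> where \<sigma>: "automorphism M \<sigma>" "map \<sigma> u = v"
    "\<And>x. fst (snd (F h)) x = (if x \<in> realizations M q \<and> \<pi> x = Some u then Some (map \<sigma> x) else None)"
    using binding_groupoid_morphism[OF Mor[OF hM]] Dom by metis
  let ?b = "map \<sigma> a"
  have b: "?b \<in> realizations M q" using realizations_q_automorphism[OF \<sigma>(1)] a(1) by blast
  have commute: "map \<sigma> (map \<tau> a) = map \<tau> ?b"
    if \<tau>: "automorphism M \<tau>" "map \<tau> u = u" "map \<tau> v = v" for \<tau>
  proof -
    have "map \<tau> h = h"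
      using definable_fun_automorphism[OF g(1) \<tau>(1) h(2)] \<tau>(2,3) h(2) by simp
    moreover have "fst (snd (F h)) a = Some ?b" using \<sigma>(3) a by simp
    then have "h @ a @ ?b \<in> D" using eq hM by blast
    then have "map \<tau> (h @ a @ ?b) \<in> D" using definable_automorphism[OF D \<tau>(1)] by blast
    ultimately have "h @ map \<tau> a @ map \<tau> ?b \<in> D" by (simp only: map_append)
    moreover have "map \<tau> a \<in> realizations M q" "map \<tau> ?b \<in> realizations M q"
      using realizations_q_automorphism[OF \<tau>(1)] a(1) b by blast+
    ultimately have
      "h @ map \<tau> a @ map \<tau> ?b \<in> {h @ a @ b | h a b. h \<in> Mor H \<and> (fst (snd (F h))) a = Some b}"
      using eq hM by blast
    then obtain h' x y where *: "h @ map \<tau> a @ map \<tau> ?b = h' @ x @ y" "h' \<in> Mor H"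
      "fst (snd (F h')) x = Some y"
      by blast
    \<comment> \<open>The lengths are needed to cut the concatenation \<open>h @ map \<tau> a @ map \<tau> ?b\<close> at the right places.\<close>
    have "x \<in> realizations M q"
      using binding_groupoid_morphism[OF Mor[OF *(2)]] *(3) by (metis option.distinct(1))
    then have "length x = length (map \<tau> a)" using length_q a(1) by simp
    moreover have "length h' = length h" using length_Mor hM *(2) by simp
    ultimately have "h' = h" "x = map \<tau> a" "y = map \<tau> ?b" using *(1) by auto
    then show ?thesis using *(3) \<sigma>(3) by (metis option.distinct(1) option.inject)
  qed
  show thesis
  proof (rule that)
    show "?b \<in> realizations M q" by (rule b)
    show "\<pi> ?b = Some v"
      using definable_fun_automorphism[OF definable \<sigma>(1) a(2)] \<sigma>(2) by simp
    fix \<tau> assume \<tau>: "automorphism M \<tau>" "map \<tau> u = u" "map \<tau> v = v"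
    show "map \<tau> a = a \<longleftrightarrow> map \<tau> ?b = ?b"
      using commute[OF \<tau>] map_inv_automorphism(1)[OF \<sigma>(1)] by metis
  qed
qed

end

theorem corollary4p4:
  fixes \<kappa> :: "'k rel"
    and M :: "('f, 'r, 's, 'm) model"
    and P :: "('f, 'r, 's, 'm) ptype set"
    and q :: "('f, 'r, 's, 'm) ptype"
    and \<pi> :: "'m list \<rightharpoonup> 'm list"
    and H :: "('m list, 'm list) gpd"
    and ts os ms :: "'s list"
  assumes "monster \<kappa> M"
    and "stable_theory M"
    and "eliminates_imaginaries M"
    and "acl M {} = dcl M {}"
    and "\<forall>\<Phi> \<in> P. partial_type M {} \<Phi>"
    and "complete_type M {} q"
    and "definable_fun M {} (fst q) ts \<pi>"
    and "realizations M q \<subseteq> dom \<pi>"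
    and "relatively_internal \<kappa> M P \<pi> q"
    and "type_definable_binding_groupoid M P \<pi> q os ms H"
    and "retractable M os ms H"
    and "internal \<kappa> M P {} (image_type M \<pi> q)"
  shows "internal \<kappa> M P {} q"
proof -
  interpret fibred_type \<kappa> M q \<pi> ts by unfold_locales (fact assms)+
  let ?P = "realizes_family M P"
  obtain B\<^sub>0 u\<^sub>0 cs\<^sub>0 where B\<^sub>0: "small \<kappa> B\<^sub>0" "u\<^sub>0 \<in> realizations M (image_type M \<pi> q)"
    "independent M {} u\<^sub>0 B\<^sub>0" "set cs\<^sub>0 \<subseteq> ?P" "set u\<^sub>0 \<subseteq> dcl M (set (concat cs\<^sub>0) \<union> B\<^sub>0)"
    using assms(12) unfolding internal_def by blast
  obtain a\<^sub>0 where a\<^sub>0: "a\<^sub>0 \<in> realizations M q" "\<pi> a\<^sub>0 = Some u\<^sub>0"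
    using B\<^sub>0(2) by (rule image_type_lift)
  have fibre: "stationary \<kappa> M (set u) (tp M (set u) a)" "internal \<kappa> M P (set u) (tp M (set u) a)"
    if "a \<in> realizations M q" "\<pi> a = Some u" for a u
    using assms(9) that by (auto simp: relatively_internal_def)
  obtain B\<^sub>1 b\<^sub>1 cs\<^sub>1 where B\<^sub>1: "small \<kappa> B\<^sub>1" "set u\<^sub>0 \<subseteq> B\<^sub>1" "b\<^sub>1 \<in> realizations M (tp M (set u\<^sub>0) a\<^sub>0)"
    "independent M (set u\<^sub>0) b\<^sub>1 B\<^sub>1" "set cs\<^sub>1 \<subseteq> ?P" "set b\<^sub>1 \<subseteq> dcl M (set (concat cs\<^sub>1) \<union> B\<^sub>1)"
    using fibre(2)[OF a\<^sub>0] unfolding internal_def by blast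
  define D where "D = B\<^sub>0 \<union> B\<^sub>1"
  have D: "small \<kappa> D" "B\<^sub>0 \<subseteq> D" "set u\<^sub>0 \<subseteq> D" "B\<^sub>1 \<subseteq> D"
    using B\<^sub>0(1) B\<^sub>1(1,2) by (auto simp: D_def small_Un)
  obtain u where u: "tp M B\<^sub>0 u = tp M B\<^sub>0 u\<^sub>0" "independent M {} u D"
    using nonforking_extension[OF D(1) _ D(2) B\<^sub>0(3)] by blast
  obtain \<sigma>\<^sub>0 where \<sigma>\<^sub>0: "automorphism M \<sigma>\<^sub>0" "\<forall>x\<in>B\<^sub>0. \<sigma>\<^sub>0 x = x" "map \<sigma>\<^sub>0 u\<^sub>0 = u"
    using conjugate[OF B\<^sub>0(1) u(1)[symmetric]] by blast
  have uq: "u \<in> realizations M (image_type M \<pi> q)"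
    using image_type_automorphism[OF \<sigma>\<^sub>0(1) B\<^sub>0(2)] \<sigma>\<^sub>0(3) by simp
  then obtain a' where a': "a' \<in> realizations M q" "\<pi> a' = Some u"
    by (rule image_type_lift)
  have "small \<kappa> (D \<union> set u)" using D(1) by (simp add: small_Un small_finite)
  then obtain a where a: "a \<in> realizations M (tp M (set u) a')"
    "independent M (set u) a (D \<union> set u)"
    using stationary_extension[OF fibre(1)[OF a'], of "D \<union> set u"] by blast
  then have aq: "a \<in> realizations M q" "\<pi> a = Some u"
    using realizations_fibre[OF a'] by auto
  have "independent M (set u) a D" by (rule independent_subset[OF a(2)]) auto
  then have ua: "independent M {} (u @ a) D" by (rule independent_append[OF D(1) u(2)])
  obtain b where b: "b \<in> realizations M q" "\<pi> b = Some u\<^sub>0"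
    "\<And>\<tau>. automorphism M \<tau> \<Longrightarrow> map \<tau> u = u \<Longrightarrow> map \<tau> u\<^sub>0 = u\<^sub>0 \<Longrightarrow> map \<tau> a = a \<longleftrightarrow> map \<tau> b = b"
    using retraction_transport[OF assms(10,11) uq B\<^sub>0(2) aq] by blast
  have "definable M (set (u @ a) \<union> set u\<^sub>0) (map (sort_of M) b) {b}"
  proof (rule fixed_imp_definable)
    fix \<tau> assume "automorphism M \<tau>" "\<forall>x\<in>set (u @ a) \<union> set u\<^sub>0. \<tau> x = x"
    moreover from this have "map \<tau> u = u" "map \<tau> u\<^sub>0 = u\<^sub>0" "map \<tau> a = a"
      by (simp_all add: map_fixed_iff)
    ultimately show "map \<tau> b = b" using b(3) by blast
  qed (simp add: small_finite)
  then have "independent M (set u\<^sub>0) b D"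
    by (rule independent_definable[OF D(1) ua empty_subsetI D(3)])
  then have "independent M (set u\<^sub>0) b B\<^sub>1" by (rule independent_subset) (use D(4) in auto)
  moreover have "b \<in> realizations M (tp M (set u\<^sub>0) a\<^sub>0)"
    using realizations_fibre[OF a\<^sub>0] b(1,2) by blast
  ultimately have "tp M B\<^sub>1 b\<^sub>1 = tp M B\<^sub>1 b"
    using stationary_unique[OF fibre(1)[OF a\<^sub>0] B\<^sub>1(1,2)] B\<^sub>1(3,4) by blast
  then obtain \<sigma>\<^sub>1 where \<sigma>\<^sub>1: "automorphism M \<sigma>\<^sub>1" "\<forall>x\<in>B\<^sub>1. \<sigma>\<^sub>1 x = x" "map \<sigma>\<^sub>1 b\<^sub>1 = b"
    using conjugate[OF B\<^sub>1(1)] by blast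
  define cs where "cs = map (map \<sigma>\<^sub>0) cs\<^sub>0 @ map (map \<sigma>\<^sub>1) cs\<^sub>1"
  have images: "\<sigma>\<^sub>0 ` (set (concat cs\<^sub>0) \<union> B\<^sub>0) \<subseteq> set (concat cs) \<union> D"
    "\<sigma>\<^sub>1 ` (set (concat cs\<^sub>1) \<union> B\<^sub>1) \<subseteq> set (concat cs) \<union> D"
    using \<sigma>\<^sub>0(2) \<sigma>\<^sub>1(2) D(2,4) by (auto simp: cs_def)
  have "set cs \<subseteq> ?P"
    using B\<^sub>0(4) B\<^sub>1(5) realizes_family_automorphism[OF assms(5) \<sigma>\<^sub>0(1)]
      realizes_family_automorphism[OF assms(5) \<sigma>\<^sub>1(1)] by (auto simp: cs_def)
  moreover have "set a \<subseteq> dcl M (set (concat cs) \<union> D)"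
  proof
    fix x assume x: "x \<in> set a"
    show "x \<in> dcl M (set (concat cs) \<union> D)"
    proof (rule fixed_imp_dcl)
      show "small \<kappa> (set (concat cs) \<union> D)" using D(1) by (simp add: small_Un small_finite)
    next
      fix \<tau> assume \<tau>: "automorphism M \<tau>" "\<forall>x\<in>set (concat cs) \<union> D. \<tau> x = x"
      have "\<tau> y = y" if y: "y \<in> set u" for y
      proof -
        obtain z where z: "z \<in> set u\<^sub>0" "y = \<sigma>\<^sub>0 z" using y unfolding \<sigma>\<^sub>0(3)[symmetric] by auto
        then have "y \<in> dcl M (\<sigma>\<^sub>0 ` (set (concat cs\<^sub>0) \<union> B\<^sub>0))"
          using B\<^sub>0(5) dcl_automorphism[OF _ \<sigma>\<^sub>0(1)] by blast
        then show ?thesis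
          by (rule dcl_fixed[OF _ \<tau>(1)]) (use \<tau>(2) images(1) in blast)
      qed
      moreover have "\<tau> y = y" if y: "y \<in> set b" for y
      proof -
        obtain z where z: "z \<in> set b\<^sub>1" "y = \<sigma>\<^sub>1 z" using y unfolding \<sigma>\<^sub>1(3)[symmetric] by auto
        then have "y \<in> dcl M (\<sigma>\<^sub>1 ` (set (concat cs\<^sub>1) \<union> B\<^sub>1))"
          using B\<^sub>1(6) dcl_automorphism[OF _ \<sigma>\<^sub>1(1)] by blast
        then show ?thesis
          by (rule dcl_fixed[OF _ \<tau>(1)]) (use \<tau>(2) images(2) in blast)
      qed
      moreover have "\<tau> y = y" if "y \<in> set u\<^sub>0" for y using that D(3) \<tau>(2) by blast
      ultimately have "map \<tau> a = a" using b(3)[OF \<tau>(1)] by (simp add: map_fixed_iff)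
      then show "\<tau> x = x" using x by (simp add: map_fixed_iff)
    qed
  qed
  moreover have "independent M {} a D"
  proof -
    have "definable M (set (u @ a) \<union> set []) (map (sort_of M) a) {a}"
      by (rule fixed_imp_definable) (simp_all add: small_finite map_fixed_iff)
    then show ?thesis using independent_definable[OF D(1) ua, of "[]" a] by simp
  qed
  ultimately show ?thesis
    unfolding internal_def using D(1) aq(1) by blast
qed

end
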